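(* Let $x_0\in\partial\Omega$. There exists a core barrier $\mathcal V(w,x)=\Psi(w,d(x))+\chi(x)$ with uniform recession negativity at $x_0$ if and only if (MRC) holds at $x_0$. Any such barrier, with $c_w=\Psi_w(0,0)$ and $c_d=\Psi_d(0,0)$, forces $$\inf_{(j,g)\in\mathcal R^*_{x_0}}\Bigl(j+\frac{c_d}{c_w}g\Bigr)>0$$ when $c_d>0$; if $c_d=0$, the same conclusion holds with $c_d/c_w$ replaced by a sufficiently small positive slope. Conversely, for any slope $\tau>0$ supplied by (MRC), i.e. with $\inf_{(j,g)\in\mathcal R^*_{x_0}}(j+\tau g)>0$, a barrier of the form $\Phi_\mu(w)+\tau d-Nd^2$ (that is, $\Psi(s,d)=\Phi_\mu(s)+\tau d-Nd^2$, $\chi\equiv0$, for suitable constants $\mu,N>0$) realizes this slope.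
   Context: Let $\Omega\subset\mathbb R^n$, $n\ge2$, be a bounded smooth domain, $0<\theta<n\pi/2$, $K\subset\mathbb R^n$ compact and convex, $\underline u\in C^3(\overline\Omega)$ convex. $X:Y=\mathrm{tr}(XY)$; $|X|$ is the operator norm; $\mathrm{Sym}(n)$ is the space of real symmetric matrices. For $t\in[0,1]$: $w_t(p)=\sqrt{1+t^2|p|^2}$, $B_t(p)=(I+t^2p\otimes p)^{-1/2}$, $A_t(p,X)=\frac1{w_t(p)}B_t(p)XB_t(p)$, $F(M)=\sum_i\arctan\lambda_i(M)$, $G_t(p,X)=F(A_t(p,X))$. A level jet is $(t,p,X)\in[0,1]\times K\times\mathrm{Sym}(n)$ with $X\ge0$, $G_t(p,X)=\theta$; a level jet $(x,t,p,X)$ also carries a base point $x$. On it let $a^{ij}=\partial G_t/\partial X_{ij}$, $b^k=\partial G_t/\partial p_k$, $a(\xi,\eta)=a^{ij}\xi_i\eta_j$. Let $d$ be the inward distance to $\partial\Omega$ in a fixed collar and $$\mathcal J=a:(D^2\underline u(x)-X)+b\cdot(D\underline u(x)-p),\quad \ell=a:D^2d(x)+b\cdot Dd(x),\quad Q=a(p-D\underline u(x),p-D\underline u(x)).$$ A doubly degenerate recession sequence based at $x_0$ is a sequence of level jets $(x_m,t_m,p_m,X_m)$, $x_m$ in the collar, with $x_m\to x_0$, $|X_m|\to\infty$, $a^{(m)}(Dd(x_m),Dd(x_m))\to0$, $Q^{(m)}\to0$ (superscript $(m)$: evaluation at the $m$-th jet). $\mathcal R^*_{x_0}$ is the set of subsequential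 limits $(j,g)$ of $(\mathcal J^{(m)},-\ell^{(m)})$ along all such sequences (empty if there are none). (MRC) holds at $x_0$ if there is $\tau_{x_0}>0$ with $\inf_{(j,g)\in\mathcal R^*_{x_0}}(j+\tau_{x_0}g)>0$; the infimum over the empty set is $+\infty$. Core barriers. A core barrier at $x_0$ is $\mathcal V(w,x)=\Psi(w,d(x))+\chi(x)$, where $w$ stands for $u-\underline u$, $\Psi$ is smooth near $(0,0)$ with $\Psi(0,0)=0$, $c_w:=\Psi_w(0,0)>0$, $c_d:=\Psi_d(0,0)\ge0$, and $\chi$ is smooth in a full neighborhood of $x_0$ in $\mathbb R^n$ with an ambient local minimum at $x_0$, normalized so that $\chi(x_0)=0$, $D\chi(x_0)=0$, $D^2\chi(x_0)\ge0$. For a level jet $(t,p,X)$ at $x$ and $s\in\mathbb R$ define $$\mathcal L_{(t,p,X)}\mathcal V[s]=-\Psi_w\mathcal J+\Psi_d\ell+\Psi_{ww}Q+2\Psi_{wd}\,a(p-D\underline u,Dd)+\Psi_{dd}\,a(Dd,Dd)+a:D^2\chi+b\cdot D\chi,$$ with all derivatives of $\Psi$ evaluated at $(s,d(x))$. Fix a constant $C_{\rm col}>0$ (such that $0\le u-\underline u\le C_{\rm col}d$ in the collar for the solutions under consideration). $\mathcal V$ has uniform recession negativity at $x_0$ if there are a neighborhood $U$ of $x_0$ and constants $R<\infty$, $\eta,\zeta,c>0$ such that $\mathcal L_{(t,p,X)}\mathcal V[s]\le-c$ whenever $0\le s\le C_{\rm col}d(x)$, $x\in U$ (in the collar), $|X|\ge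 R$, $a(Dd,Dd)\le\eta$ and $Q\le\zeta$. Finally $\Phi_\mu(s)=(1-e^{-\mu s})/\mu$ for $\mu>0$. A core barrier "realizes the slope $\tau$" if it has uniform recession negativity at $x_0$ and $c_d/c_w=\tau$. *)

theory Defs
  imports "HOL-Analysis.Analysis"
begin

section \<open>Derivatives and smoothness, up to the boundary\<close>

text \<open>
  All derivatives are taken within a set \<open>S\<close>. For open \<open>S\<close> these are the ordinary
  derivatives; for the closure of a smooth domain the derivative within \<open>S\<close> is still unique, also
  at boundary points, where it is the continuous extension of the interior derivative.
\<close>

definition grad :: "'a::euclidean_space set \<Rightarrow> ('a \<Rightarrow> real) \<Rightarrow> 'a \<Rightarrow> 'a" where
  "grad S f x = (THE g. (f has_derivative (\<lambda>h. g \<bullet> h)) (at x within S))"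

definition hess :: "(real^'n) set \<Rightarrow> (real^'n \<Rightarrow> real) \<Rightarrow> real^'n \<Rightarrow> real^'n^'n" where
  "hess S f x = (THE H. (grad S f has_derivative (\<lambda>h. H *v h)) (at x within S))"

primrec Ck_on :: "nat \<Rightarrow> 'a::euclidean_space set \<Rightarrow> ('a \<Rightarrow> real) \<Rightarrow> bool" where
  "Ck_on 0 S f \<longleftrightarrow> continuous_on S f"
| "Ck_on (Suc k) S f \<longleftrightarrow>
     (\<exists>g. (\<forall>x\<in>S. (f has_derivative (\<lambda>h. g x \<bullet> h)) (at x within S)) \<and>
          (\<forall>b\<in>Basis. Ck_on k S (\<lambda>x. g x \<bullet> b)))"

definition smooth_on :: "'a::euclidean_space set \<Rightarrow> ('a \<Rightarrow> real) \<Rightarrow> bool" where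
  "smooth_on S f \<longleftrightarrow> (\<forall>k. Ck_on k S f)"

text \<open>Partial derivatives of a function of two real variables \<open>(w, d)\<close>.\<close>

definition dw :: "(real \<times> real \<Rightarrow> real) \<Rightarrow> real \<times> real \<Rightarrow> real" where
  "dw \<Psi> z = deriv (\<lambda>s. \<Psi> (s, snd z)) (fst z)"

definition dd :: "(real \<times> real \<Rightarrow> real) \<Rightarrow> real \<times> real \<Rightarrow> real" where
  "dd \<Psi> z = deriv (\<lambda>r. \<Psi> (fst z, r)) (snd z)"


section \<open>Domain, boundary distance and collar\<close>

text \<open>The boundary is a smooth hypersurface and the domain lies locally on one side of it.\<close>

definition smooth_domain :: "'a::euclidean_space set \<Rightarrow> bool" where
  "smooth_domain \<Omega> \<longleftrightarrow> \<Omega> \<noteq> {} \<and> open \<Omega> \<and> connected \<Omega> \<and>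
     (\<forall>y\<in>frontier \<Omega>. \<exists>U \<rho>. open U \<and> y \<in> U \<and> smooth_on U \<rho> \<and>
        (\<forall>x\<in>U. grad UNIV \<rho> x \<noteq> 0) \<and>
        \<Omega> \<inter> U = {x\<in>U. \<rho> x > 0} \<and> frontier \<Omega> \<inter> U = {x\<in>U. \<rho> x = 0})"

definition bdist :: "'a::euclidean_space set \<Rightarrow> 'a \<Rightarrow> real" where
  "bdist \<Omega> x = infdist x (frontier \<Omega>)"

definition collar :: "'a::euclidean_space set \<Rightarrow> real \<Rightarrow> 'a set" where
  "collar \<Omega> r = {x \<in> closure \<Omega>. bdist \<Omega> x < r}"

definition collar_width :: "'a::euclidean_space set \<Rightarrow> real \<Rightarrow> bool" where
  "collar_width \<Omega> r \<longleftrightarrow> r > 0 \<and> smooth_on (collar \<Omega> r) (bdist \<Omega>)"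

text \<open>
  The library's \<open>convex_on\<close> includes convexity of the set. As the domain need not be
  convex, convexity of a function is required along the segments contained in the set.
\<close>

definition convex_fun_on :: "'a::real_vector set \<Rightarrow> ('a \<Rightarrow> real) \<Rightarrow> bool" where
  "convex_fun_on S f \<longleftrightarrow>
     (\<forall>x y. closed_segment x y \<subseteq> S \<longrightarrow> convex_on (closed_segment x y) f)"


section \<open>The operator\<close>

definition Sym :: "(real^'n^'n) set" where
  "Sym = {X. transpose X = X}"

definition psd :: "real^'n^'n \<Rightarrow> bool" where
  "psd X \<longleftrightarrow> X \<in> Sym \<and> (\<forall>v. 0 \<le> v \<bullet> (X *v v))"

definition outer :: "real^'n \<Rightarrow> real^'n \<Rightarrow> real^'n^'n" where
  "outer p q = (\<chi> i j. p $ i * q $ j)"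

definition opnorm :: "real^'n^'n \<Rightarrow> real" where
  "opnorm X = onorm (\<lambda>v. X *v v)"

text \<open>\<open>S\<close> to the power \<open>-1/2\<close>, for symmetric positive definite \<open>S\<close>.\<close>

definition inv_sqrt :: "real^'n^'n \<Rightarrow> real^'n^'n" where
  "inv_sqrt S = (THE B. B \<in> Sym \<and> (\<forall>v. v \<noteq> 0 \<longrightarrow> 0 < v \<bullet> (B *v v)) \<and> B ** B = matrix_inv S)"

text \<open>
  \<open>F M\<close> sums \<open>arctan\<close> over the eigenvalues with multiplicity; only symmetric \<open>M\<close> are
  relevant, for which the multiplicity is the dimension of the eigenspace.
\<close>

definition F :: "real^'n^'n \<Rightarrow> real" where
  "F M = (\<Sum>l | \<exists>v. v \<noteq> 0 \<and> M *v v = l *\<^sub>R v. real (dim {v. M *v v = l *\<^sub>R v}) * arctan l)"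

definition wfun :: "real \<Rightarrow> real^'n \<Rightarrow> real" where
  "wfun t p = sqrt (1 + t\<^sup>2 * (norm p)\<^sup>2)"

definition Bmat :: "real \<Rightarrow> real^'n \<Rightarrow> real^'n^'n" where
  "Bmat t p = inv_sqrt (mat 1 + t\<^sup>2 *\<^sub>R outer p p)"

definition Amat :: "real \<Rightarrow> real^'n \<Rightarrow> real^'n^'n \<Rightarrow> real^'n^'n" where
  "Amat t p X = (1 / wfun t p) *\<^sub>R (Bmat t p ** X ** Bmat t p)"

definition G :: "real \<Rightarrow> real^'n \<Rightarrow> real^'n^'n \<Rightarrow> real" where
  "G t p X = F (Amat t p X)"


section \<open>Level jets\<close>

type_synonym 'n jet = "real \<times> (real^'n) \<times> (real^'n^'n)"

definition level_jet :: "(real^'n) set \<Rightarrow> real \<Rightarrow> 'n jet \<Rightarrow> bool" where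
  "level_jet K \<theta> J = (case J of (t, p, X) \<Rightarrow>
     t \<in> {0..1} \<and> p \<in> K \<and> psd X \<and> G t p X = \<theta>)"

text \<open>
  The matrix \<open>a\<close> represents the derivative of \<open>G t p\<close> on the space \<open>Sym\<close> with
  respect to the trace pairing, and is itself symmetric.
\<close>

definition acoef :: "'n jet \<Rightarrow> real^'n^'n" where
  "acoef J = (case J of (t, p, X) \<Rightarrow>
     THE a. a \<in> Sym \<and> (G t p has_derivative (\<lambda>Y. trace (a ** Y))) (at X within Sym))"

definition bcoef :: "'n jet \<Rightarrow> real^'n" where
  "bcoef J = (case J of (t, p, X) \<Rightarrow> grad UNIV (\<lambda>q. G t q X) p)"

definition aform :: "'n jet \<Rightarrow> real^'n \<Rightarrow> real^'n \<Rightarrow> real" where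
  "aform J \<xi> \<eta> = \<xi> \<bullet> (acoef J *v \<eta>)"

definition jet_p :: "'n jet \<Rightarrow> real^'n" where
  "jet_p J = fst (snd J)"

definition jet_X :: "'n jet \<Rightarrow> real^'n^'n" where
  "jet_X J = snd (snd J)"

definition Jfun :: "(real^'n) set \<Rightarrow> (real^'n \<Rightarrow> real) \<Rightarrow> real^'n \<Rightarrow> 'n jet \<Rightarrow> real" where
  "Jfun \<Omega> u x J = trace (acoef J ** (hess (closure \<Omega>) u x - jet_X J))
     + bcoef J \<bullet> (grad (closure \<Omega>) u x - jet_p J)"

definition lfun :: "(real^'n) set \<Rightarrow> real^'n \<Rightarrow> 'n jet \<Rightarrow> real" where
  "lfun \<Omega> x J = trace (acoef J ** hess (closure \<Omega>) (bdist \<Omega>) x)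
     + bcoef J \<bullet> grad (closure \<Omega>) (bdist \<Omega>) x"

definition Qfun :: "(real^'n) set \<Rightarrow> (real^'n \<Rightarrow> real) \<Rightarrow> real^'n \<Rightarrow> 'n jet \<Rightarrow> real" where
  "Qfun \<Omega> u x J =
     aform J (jet_p J - grad (closure \<Omega>) u x) (jet_p J - grad (closure \<Omega>) u x)"

definition anu :: "(real^'n) set \<Rightarrow> real^'n \<Rightarrow> 'n jet \<Rightarrow> real" where
  "anu \<Omega> x J = aform J (grad (closure \<Omega>) (bdist \<Omega>) x) (grad (closure \<Omega>) (bdist \<Omega>) x)"


section \<open>The recession set and (MRC)\<close>

definition recession_seq ::
  "(real^'n) set \<Rightarrow> real \<Rightarrow> (real^'n \<Rightarrow> real) \<Rightarrow> (real^'n) set \<Rightarrow> real \<Rightarrow> real^'n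
    \<Rightarrow> (nat \<Rightarrow> real^'n) \<Rightarrow> (nat \<Rightarrow> 'n jet) \<Rightarrow> bool" where
  "recession_seq \<Omega> r u K \<theta> x0 x J \<longleftrightarrow>
     (\<forall>m. x m \<in> collar \<Omega> r \<and> level_jet K \<theta> (J m)) \<and>
     x \<longlonglongrightarrow> x0 \<and>
     filterlim (\<lambda>m. opnorm (jet_X (J m))) at_top sequentially \<and>
     (\<lambda>m. anu \<Omega> (x m) (J m)) \<longlonglongrightarrow> 0 \<and>
     (\<lambda>m. Qfun \<Omega> u (x m) (J m)) \<longlonglongrightarrow> 0"

definition recession_set ::
  "(real^'n) set \<Rightarrow> real \<Rightarrow> (real^'n \<Rightarrow> real) \<Rightarrow> (real^'n) set \<Rightarrow> real \<Rightarrow> real^'n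
    \<Rightarrow> (real \<times> real) set" where
  "recession_set \<Omega> r u K \<theta> x0 = {(j, g). \<exists>x J \<sigma>.
     recession_seq \<Omega> r u K \<theta> x0 x J \<and> strict_mono (\<sigma> :: nat \<Rightarrow> nat) \<and>
     (\<lambda>m. Jfun \<Omega> u (x (\<sigma> m)) (J (\<sigma> m))) \<longlonglongrightarrow> j \<and>
     (\<lambda>m. - lfun \<Omega> (x (\<sigma> m)) (J (\<sigma> m))) \<longlonglongrightarrow> g}"

text \<open>Taken in \<open>ereal\<close>, so that the infimum over the empty set is \<open>\<infinity>\<close>.\<close>

definition slope_inf :: "(real \<times> real) set \<Rightarrow> real \<Rightarrow> ereal" where
  "slope_inf R \<tau> = (INF (j, g)\<in>R. ereal (j + \<tau> * g))"

definition MRC ::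
  "(real^'n) set \<Rightarrow> real \<Rightarrow> (real^'n \<Rightarrow> real) \<Rightarrow> (real^'n) set \<Rightarrow> real \<Rightarrow> real^'n \<Rightarrow> bool" where
  "MRC \<Omega> r u K \<theta> x0 \<longleftrightarrow> (\<exists>\<tau>>0. slope_inf (recession_set \<Omega> r u K \<theta> x0) \<tau> > 0)"


section \<open>Core barriers\<close>

text \<open>
  The barrier \<open>\<Psi> (w, d x) + \<phi> x\<close> is represented by the pair \<open>\<Psi>\<close>, \<open>\<phi>\<close>,
  since \<open>dw \<Psi>\<close>, \<open>dd \<Psi>\<close> and the linearised operator depend on this decomposition.
  (\<open>\<phi>\<close> is usually called chi, which is reserved for vector notation here.)
\<close>

definition core_barrier ::
  "real^'n \<Rightarrow> (real \<times> real \<Rightarrow> real) \<Rightarrow> (real^'n \<Rightarrow> real) \<Rightarrow> bool" where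
  "core_barrier x0 \<Psi> \<phi> \<longleftrightarrow>
     (\<exists>W. open W \<and> (0, 0) \<in> W \<and> smooth_on W \<Psi>) \<and>
     \<Psi> (0, 0) = 0 \<and> dw \<Psi> (0, 0) > 0 \<and> dd \<Psi> (0, 0) \<ge> 0 \<and>
     (\<exists>U. open U \<and> x0 \<in> U \<and> smooth_on U \<phi>) \<and>
     (\<forall>\<^sub>F x in nhds x0. \<phi> x0 \<le> \<phi> x) \<and>
     \<phi> x0 = 0 \<and> grad UNIV \<phi> x0 = 0 \<and> psd (hess UNIV \<phi> x0)"

definition Lop ::
  "(real^'n) set \<Rightarrow> (real^'n \<Rightarrow> real) \<Rightarrow> (real \<times> real \<Rightarrow> real) \<Rightarrow> (real^'n \<Rightarrow> real)
    \<Rightarrow> real^'n \<Rightarrow> 'n jet \<Rightarrow> real \<Rightarrow> real" where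
  "Lop \<Omega> u \<Psi> \<phi> x J s = (let z = (s, bdist \<Omega> x) in
     - dw \<Psi> z * Jfun \<Omega> u x J + dd \<Psi> z * lfun \<Omega> x J
     + dw (dw \<Psi>) z * Qfun \<Omega> u x J
     + 2 * dd (dw \<Psi>) z *
         aform J (jet_p J - grad (closure \<Omega>) u x) (grad (closure \<Omega>) (bdist \<Omega>) x)
     + dd (dd \<Psi>) z * anu \<Omega> x J
     + trace (acoef J ** hess UNIV \<phi> x) + bcoef J \<bullet> grad UNIV \<phi> x)"

text \<open>
  The barrier is differentiable only near \<open>(0, 0)\<close> and \<open>x0\<close>; the neighbourhood
  \<open>U\<close> may always be shrunk, so points outside that region play no role.
\<close>

definition recession_negative ::
  "(real^'n) set \<Rightarrow> real \<Rightarrow> (real^'n \<Rightarrow> real) \<Rightarrow> (real^'n) set \<Rightarrow> real \<Rightarrow> real \<Rightarrow> real^'n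
    \<Rightarrow> (real \<times> real \<Rightarrow> real) \<Rightarrow> (real^'n \<Rightarrow> real) \<Rightarrow> bool" where
  "recession_negative \<Omega> r u K \<theta> Ccol x0 \<Psi> \<phi> \<longleftrightarrow>
     (\<exists>U R \<eta> \<zeta> c. open U \<and> x0 \<in> U \<and> \<eta> > 0 \<and> \<zeta> > 0 \<and> c > 0 \<and>
       (\<forall>x s J. x \<in> U \<inter> collar \<Omega> r \<and> 0 \<le> s \<and> s \<le> Ccol * bdist \<Omega> x \<and>
          level_jet K \<theta> J \<and> opnorm (jet_X J) \<ge> R \<and> anu \<Omega> x J \<le> \<eta> \<and> Qfun \<Omega> u x J \<le> \<zeta>
          \<longrightarrow> Lop \<Omega> u \<Psi> \<phi> x J s \<le> - c))"

definition realizes_slope ::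
  "(real^'n) set \<Rightarrow> real \<Rightarrow> (real^'n \<Rightarrow> real) \<Rightarrow> (real^'n) set \<Rightarrow> real \<Rightarrow> real \<Rightarrow> real^'n
    \<Rightarrow> (real \<times> real \<Rightarrow> real) \<Rightarrow> (real^'n \<Rightarrow> real) \<Rightarrow> real \<Rightarrow> bool" where
  "realizes_slope \<Omega> r u K \<theta> Ccol x0 \<Psi> \<phi> \<tau> \<longleftrightarrow>
     core_barrier x0 \<Psi> \<phi> \<and> recession_negative \<Omega> r u K \<theta> Ccol x0 \<Psi> \<phi> \<and>
     dd \<Psi> (0, 0) / dw \<Psi> (0, 0) = \<tau>"

definition Phi :: "real \<Rightarrow> real \<Rightarrow> real" where
  "Phi \<mu> s = (1 - exp (- \<mu> * s)) / \<mu>"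

end

(* Everything rests on uniform bounds for the coefficients on level jets. The spectral function F is
   differentiable on the symmetric matrices with derivative tr((1 + M^2)^-1 Y), by a Klein type
   second order expansion. Hence a is positive semidefinite and bounded, and a:X and b are bounded
   because x / (1 + x^2) is. So the values of the pair (J, g) stay bounded along recession sequences.

   If a barrier has uniform recession negativity, evaluating at s = 0 along a recession sequence
   kills all quadratic terms, the D^2 chi term has nonnegative lower limit, and the limit reads
   c_w j + c_d g >= c. Conversely, if Phi_1(w) + tau d - d^2 were not uniformly recession
   negative, violating jets for smaller and smaller parameters would form a recession sequence,
   and a limit point (j, g) would have j + tau g <= 0. *)

theory Submission
  imports Defs
begin

section \<open>The spectral theorem\<close>

text \<open>Eigenvalues of a symmetric matrix need not be differentiable where they cross, so
  \<open>F\<close> is not differentiated eigenvalue by eigenvalue; a remainder estimate, quadratic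
  in \<open>N - M\<close> with constant 1 for all matrices, replaces perturbation theory. The bounds
  on a:X and b are delicate because X is unbounded: differentiating A in X along X, or in p, leaves
  a factor X. Tested on a unit eigenvector of A with eigenvalue l, this factor costs exactly one
  power of l, which the weight 1/(1 + l^2) absorbs. All coefficients and derivatives are definite
  descriptions, taken within \<open>Sym\<close> or within the closed domain, where points need not
  be interior; hence the separate care for uniqueness of derivatives. Finally (MRC) asks for a
  positive slope, so a barrier with c_d = 0 must give up part of its margin, which is possible
  because g is bounded on the whole recession set.\<close>

lemma Sym_inner:
  fixes M :: "real^'n^'n"
  assumes "M \<in> Sym"
  shows "x \<bullet> (M *v y) = (M *v x) \<bullet> y"
proof -
  have "x \<bullet> (M *v y) = (x v* M) \<bullet> y" by (simp add: dot_lmul_matrix)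
  also have "x v* M = transpose M *v x" by (rule transpose_matrix_vector[symmetric])
  also have "transpose M = M" using assms by (simp only: Sym_def mem_Collect_eq)
  finally show ?thesis .
qed

lemma Sym_iff_inner: "M \<in> Sym \<longleftrightarrow> (\<forall>x y. x \<bullet> (M *v y) = (M *v x) \<bullet> y)"
proof
  assume "\<forall>x y. x \<bullet> (M *v y) = (M *v x) \<bullet> y"
  then have "axis j 1 \<bullet> (M *v axis i 1) = (M *v axis j 1) \<bullet> axis i 1" for i j
    by blast
  then have "transpose M $ i $ j = M $ i $ j" for i j
    by (simp add: inner_axis inner_axis' transpose_def matrix_vector_mul_component)
  then show "M \<in> Sym" by (simp add: Sym_def vec_eq_iff)
qed (auto simp: Sym_inner)

text \<open>An orthonormal eigenbasis as a bare set. Eigenvalues are not stored: the one belonging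
  to v is recovered as v \<bullet> (M *v v). The subspace S is a parameter for the sake of the
  induction on dimension.\<close>

definition eigenbasis_of :: "(real^'n) set \<Rightarrow> real^'n^'n \<Rightarrow> (real^'n) set \<Rightarrow> bool" where
  "eigenbasis_of S M E \<longleftrightarrow> pairwise orthogonal E \<and> (\<forall>v\<in>E. norm v = 1) \<and> span E = S \<and>
     (\<forall>v\<in>E. \<exists>l. M *v v = l *\<^sub>R v)"

abbreviation eigenbasis :: "real^'n^'n \<Rightarrow> (real^'n) set \<Rightarrow> bool" where
  "eigenbasis \<equiv> eigenbasis_of UNIV"

text \<open>A maximiser of the Rayleigh quotient on the unit sphere of S is an eigenvector. Moving
  it along the residual \<open>M *v v - l *\<^sub>R v\<close>, which stays in S by invariance, would
  otherwise increase the quotient.\<close>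

lemma eigenvector_exists:
  fixes M :: "real^'n^'n"
  assumes M: "M \<in> Sym" and S: "subspace S" and inv: "\<And>x. x \<in> S \<Longrightarrow> M *v x \<in> S"
    and ne: "S \<noteq> {0}"
  shows "\<exists>v\<in>S. norm v = 1 \<and> (\<exists>l. M *v v = l *\<^sub>R v)"
proof -
  obtain x0 where x0: "x0 \<in> S" "x0 \<noteq> 0" using ne S subspace_0 by blast
  have closed: "compact (S \<inter> sphere 0 1)"
    by (simp add: S closed_subspace closed_Int_compact)
  moreover have "x0 /\<^sub>R norm x0 \<in> S \<inter> sphere 0 1"
    using x0 S by (simp add: subspace_scale)
  moreover have "continuous_on (S \<inter> sphere 0 1) (\<lambda>x. x \<bullet> (M *v x))"
    by (intro continuous_intros linear_continuous_on) auto
  ultimately obtain v where v: "v \<in> S \<inter> sphere 0 1"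
    and max: "\<And>y. y \<in> S \<inter> sphere 0 1 \<Longrightarrow> y \<bullet> (M *v y) \<le> v \<bullet> (M *v v)"
    using continuous_attains_sup[of "S \<inter> sphere 0 1" "\<lambda>x. x \<bullet> (M *v x)"] by blast
  define l where "l = v \<bullet> (M *v v)"
  have vv: "v \<bullet> v = 1" using v by (simp add: norm_eq_1)
  have le: "x \<bullet> (M *v x) \<le> l * (x \<bullet> x)" if "x \<in> S" for x
  proof (cases "x = 0")
    case False
    have "(x /\<^sub>R norm x) \<bullet> (M *v (x /\<^sub>R norm x)) \<le> l"
      unfolding l_def using that False S by (intro max) (simp add: subspace_scale)
    then have "x \<bullet> (M *v x) / (x \<bullet> x) \<le> l"
      by (simp add: matrix_vector_mult_scaleR field_simps dot_square_norm power2_eq_square)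
    then show ?thesis using False by (simp add: divide_le_eq)
  qed simp
  define y where "y = M *v v - l *\<^sub>R v"
  have yS: "y \<in> S" unfolding y_def using v inv S by (auto intro: subspace_diff subspace_scale)
  have yMv: "y \<bullet> (M *v v) = y \<bullet> y + l * (y \<bullet> v)" unfolding y_def by (simp add: algebra_simps)
  define c where "c = l * (y \<bullet> y) - y \<bullet> (M *v y)"
  \<comment> \<open>The maximality inequality at v + s y, after the terms of order zero cancel and
    one factor s is divided out.\<close>
  have s: "2 * (y \<bullet> y) \<le> s * c" if "s > 0" for s :: real
  proof -
    have "v + s *\<^sub>R y \<in> S" using v yS S by (auto intro: subspace_add subspace_scale)
    from le[OF this] have "l + 2 * s * (y \<bullet> (M *v v)) + s\<^sup>2 * (y \<bullet> (M *v y))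
        \<le> l * (1 + 2 * s * (y \<bullet> v) + s\<^sup>2 * (y \<bullet> y))"
      using Sym_inner[OF M, of v y] vv
      by (simp add: matrix_vector_right_distrib matrix_vector_mult_scaleR inner_add_left inner_add_right
          inner_commute power2_eq_square l_def[symmetric] algebra_simps)
    then have "s * (2 * (y \<bullet> y)) \<le> s * (s * c)"
      unfolding yMv c_def by (simp add: algebra_simps power2_eq_square)
    then show ?thesis using that by simp
  qed
  have "y \<bullet> y \<le> 0"
  proof (rule ccontr)
    assume a: "\<not> y \<bullet> y \<le> 0"
    \<comment> \<open>With s = |y|^2 / (1 + |c|) the right side is at most |y|^2, half of what the
      left side demands.\<close>
    have "2 * (y \<bullet> y) \<le> (y \<bullet> y) / (1 + \<bar>c\<bar>) * c"
      using a by (intro s divide_pos_pos) linarith+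
    also have "\<dots> \<le> (y \<bullet> y) * 1"
    proof -
      have "c / (1 + \<bar>c\<bar>) \<le> 1" by (subst divide_le_eq_1_pos) linarith+
      from mult_left_mono[OF this, of "y \<bullet> y"] show ?thesis by simp
    qed
    finally show False using a by simp
  qed
  then have "y = 0" by (metis inner_gt_zero_iff not_le)
  then have "M *v v = l *\<^sub>R v" by (simp add: y_def)
  moreover have "v \<in> S" "norm v = 1" using v by simp_all
  ultimately show ?thesis by blast
qed

text \<open>Split off one eigenvector v; by symmetry of M its orthogonal complement T in S is again
  invariant, and it has smaller dimension.\<close>

lemma eigenbasis_of_exists:
  fixes M :: "real^'n^'n"
  assumes M: "M \<in> Sym"
  shows "subspace S \<Longrightarrow> (\<And>x. x \<in> S \<Longrightarrow> M *v x \<in> S) \<Longrightarrow> \<exists>E. eigenbasis_of S M E"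
proof (induction "dim S" arbitrary: S rule: less_induct)
  case less
  show ?case
  proof (cases "S = {0}")
    case True
    then show ?thesis by (auto simp: eigenbasis_of_def intro!: exI[of _ "{}"])
  next
    case False
    then obtain v l where v: "v \<in> S" "norm v = 1" "M *v v = l *\<^sub>R v"
      using eigenvector_exists[OF M less.prems] by blast
    have vv: "v \<bullet> v = 1" using v by (simp add: norm_eq_1)
    define T where "T = {x \<in> S. v \<bullet> x = 0}"
    have T: "subspace T" unfolding T_def using less.prems(1)
      by (auto simp: subspace_def inner_add_right)
    have "M *v x \<in> T" if "x \<in> T" for x
    proof -
      have "v \<bullet> (M *v x) = (M *v v) \<bullet> x" by (rule Sym_inner[OF M])
      also have "\<dots> = 0" using that by (subst v(3)) (simp add: T_def)
      finally show ?thesis using that less.prems(2) by (simp add: T_def)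
    qed
    moreover have "dim T < dim S"
    proof (rule dim_psubset)
      have "v \<notin> T" "T \<subseteq> S" using vv by (auto simp: T_def)
      then have "T \<subset> S" using v(1) by blast
      then show "span T \<subset> span S"
        using T less.prems(1) by (simp add: span_eq_iff[THEN iffD2])
    qed
    ultimately obtain E where E: "eigenbasis_of T M E" using less.hyps T by blast
    have sub: "E \<subseteq> T" using E span_superset by (auto simp: eigenbasis_of_def)
    have "span (insert v E) = S"
    proof
      show "span (insert v E) \<subseteq> S"
        using sub v(1) less.prems(1) by (intro span_minimal) (auto simp: T_def)
      show "S \<subseteq> span (insert v E)"
      proof
        fix x assume "x \<in> S"
        then have "x - (v \<bullet> x) *\<^sub>R v \<in> T"
          using v(1) vv less.prems(1)
          by (auto simp: T_def inner_diff_right intro: subspace_diff subspace_scale)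
        then have "x - (v \<bullet> x) *\<^sub>R v \<in> span E" using E by (simp add: eigenbasis_of_def)
        then show "x \<in> span (insert v E)" using span_breakdown_eq by blast
      qed
    qed
    moreover have "pairwise orthogonal (insert v E)"
      using E sub unfolding eigenbasis_of_def
      by (auto simp: pairwise_insert orthogonal_def T_def inner_commute)
    ultimately have "eigenbasis_of S M (insert v E)"
      using E v by (auto simp: eigenbasis_of_def)
    then show ?thesis by blast
  qed
qed

lemma eigenbasis_exists: "M \<in> Sym \<Longrightarrow> \<exists>E. eigenbasis M E"
  using eigenbasis_of_exists[of M UNIV] by simp

section \<open>Coordinates with respect to an eigenbasis\<close>

lemma eigenbasis_independent:
  assumes "eigenbasis_of S M E"
  shows "independent E"
proof (rule pairwise_orthogonal_independent)
  show "0 \<notin> E" using assms by (force simp: eigenbasis_of_def)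
qed (use assms in \<open>simp add: eigenbasis_of_def\<close>)

lemma eigenbasis_finite: "eigenbasis_of S M E \<Longrightarrow> finite E"
  using eigenbasis_independent finiteI_independent by blast

lemma eigenbasis_card: "eigenbasis (M :: real^'n^'n) E \<Longrightarrow> card E = CARD('n)"
  using dim_eq_card[of E UNIV] eigenbasis_independent[of UNIV M E]
  by (simp add: eigenbasis_of_def)

lemma eigenbasis_norm: "eigenbasis_of S M E \<Longrightarrow> v \<in> E \<Longrightarrow> norm v = 1"
  by (simp add: eigenbasis_of_def)

lemma eigenbasis_eigen:
  assumes "eigenbasis_of S M E" "v \<in> E"
  shows "M *v v = (v \<bullet> (M *v v)) *\<^sub>R v"
proof -
  obtain l where "M *v v = l *\<^sub>R v" using assms by (auto simp: eigenbasis_of_def)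
  then show ?thesis using eigenbasis_norm[OF assms] by (simp add: dot_square_norm)
qed

lemma eigenbasis_inner_right:
  assumes "eigenbasis_of S M E" "v \<in> E"
  shows "x \<bullet> (M *v v) = (v \<bullet> (M *v v)) * (x \<bullet> v)"
  by (rule trans[OF arg_cong[OF eigenbasis_eigen[OF assms], of "\<lambda>y. x \<bullet> y"] inner_scaleR_right])

lemma eigenbasis_inner_left:
  assumes "eigenbasis_of S M E" "M \<in> Sym" "v \<in> E"
  shows "v \<bullet> (M *v x) = (v \<bullet> (M *v v)) * (v \<bullet> x)"
proof -
  have "v \<bullet> (M *v x) = x \<bullet> (M *v v)"
    using Sym_inner[OF assms(2), of v x] by (simp only: inner_commute)
  then show ?thesis
    by (simp only: eigenbasis_inner_right[OF assms(1,3), of x] inner_commute)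
qed

lemma eigenbasis_expand:
  assumes "eigenbasis M E"
  shows "(\<Sum>v\<in>E. (x \<bullet> v) *\<^sub>R v) = x"
proof (rule orthonormal_basis_expand)
  show "pairwise orthogonal E" "x \<in> span E" using assms by (simp_all add: eigenbasis_of_def)
qed (use eigenbasis_norm[OF assms] eigenbasis_finite[OF assms] in auto)

lemma eigenbasis_parseval:
  assumes "eigenbasis M E"
  shows "x \<bullet> y = (\<Sum>v\<in>E. (x \<bullet> v) * (v \<bullet> y))"
proof -
  have "x \<bullet> y = (\<Sum>v\<in>E. (x \<bullet> v) *\<^sub>R v) \<bullet> y"
    by (simp only: eigenbasis_expand[OF assms])
  then show ?thesis by (simp add: inner_sum_left)
qed

lemma eigenbasis_quadratic:
  assumes E: "eigenbasis M E" and M: "M \<in> Sym"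
  shows "x \<bullet> (M *v y) = (\<Sum>v\<in>E. (v \<bullet> (M *v v)) * (x \<bullet> v) * (v \<bullet> y))"
proof -
  have "x \<bullet> (M *v y) = (\<Sum>v\<in>E. (x \<bullet> v) * (v \<bullet> (M *v y)))" by (rule eigenbasis_parseval[OF E])
  also have "\<dots> = (\<Sum>v\<in>E. (v \<bullet> (M *v v)) * (x \<bullet> v) * (v \<bullet> y))"
    by (intro sum.cong refl) (simp only: eigenbasis_inner_left[OF E M, of _ y] mult_ac)
  finally show ?thesis .
qed

text \<open>The norm of the type \<open>real^'n^'n\<close> is the Frobenius norm; Parseval is
  applied to each row.\<close>

lemma eigenbasis_norm_matrix:
  fixes Y :: "real^'n^'n"
  assumes "eigenbasis M E"
  shows "(norm Y)\<^sup>2 = (\<Sum>v\<in>E. (norm (Y *v v))\<^sup>2)"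
proof -
  have "(norm Y)\<^sup>2 = (\<Sum>i\<in>UNIV. Y $ i \<bullet> Y $ i)"
    by (simp add: dot_square_norm[symmetric] inner_vec_def)
  also have "\<dots> = (\<Sum>i\<in>UNIV. \<Sum>v\<in>E. (Y $ i \<bullet> v) * (v \<bullet> Y $ i))"
    by (intro sum.cong refl eigenbasis_parseval[OF assms])
  also have "\<dots> = (\<Sum>v\<in>E. \<Sum>i\<in>UNIV. (Y $ i \<bullet> v) * (v \<bullet> Y $ i))" by (rule sum.swap)
  also have "\<dots> = (\<Sum>v\<in>E. (Y *v v) \<bullet> (Y *v v))"
    by (simp add: inner_vec_def[of "_ *v _" "_ *v _"] matrix_vector_mul_component inner_commute)
  finally show ?thesis by (simp add: dot_square_norm)
qed

section \<open>The spectral function and its derivative\<close>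

text \<open>By symmetry an eigenvector for l is orthogonal to every basis vector with a different
  eigenvalue. This turns the dimensions in the definition of \<open>F\<close> into numbers of basis
  vectors.\<close>

lemma eigenspace_eq_span:
  assumes E: "eigenbasis M E" and M: "M \<in> Sym"
  shows "{x. M *v x = l *\<^sub>R x} = span {v\<in>E. v \<bullet> (M *v v) = l}"
proof
  show "span {v\<in>E. v \<bullet> (M *v v) = l} \<subseteq> {x. M *v x = l *\<^sub>R x}"
  proof (rule span_minimal)
    show "subspace {x. M *v x = l *\<^sub>R x}"
      by (auto simp: subspace_def matrix_vector_right_distrib matrix_vector_mult_scaleR scaleR_add_right)
  qed (use eigenbasis_eigen[OF E] in auto)
next
  show "{x. M *v x = l *\<^sub>R x} \<subseteq> span {v\<in>E. v \<bullet> (M *v v) = l}"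
  proof
    fix x assume "x \<in> {x. M *v x = l *\<^sub>R x}"
    then have x: "M *v x = l *\<^sub>R x" by simp
    have "x \<bullet> v = 0" if "v \<in> E" "v \<bullet> (M *v v) \<noteq> l" for v
    proof -
      have "l * (x \<bullet> v) = (v \<bullet> (M *v v)) * (x \<bullet> v)"
        using Sym_inner[OF M, of x v] by (auto simp: x eigenbasis_inner_right[OF E that(1), of x])
      then show ?thesis using that by simp
    qed
    then have "(\<Sum>v\<in>E. (x \<bullet> v) *\<^sub>R v) = (\<Sum>v | v \<in> E \<and> v \<bullet> (M *v v) = l. (x \<bullet> v) *\<^sub>R v)"
      using eigenbasis_finite[OF E] by (intro sum.mono_neutral_right) auto
    moreover have "(\<Sum>v | v \<in> E \<and> v \<bullet> (M *v v) = l. (x \<bullet> v) *\<^sub>R v) \<in> span {v\<in>E. v \<bullet> (M *v v) = l}"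
      by (intro span_sum span_scale span_base) auto
    ultimately show "x \<in> span {v\<in>E. v \<bullet> (M *v v) = l}"
      by (simp add: eigenbasis_expand[OF E])
  qed
qed

text \<open>Grouping E by eigenvalue reproduces the sum with multiplicities. Since any eigenbasis
  may be used, no ordering or continuous choice of eigenvectors is ever required.\<close>

lemma F_eigenbasis:
  assumes E: "eigenbasis M E" and M: "M \<in> Sym"
  shows "F M = (\<Sum>v\<in>E. arctan (v \<bullet> (M *v v)))"
proof -
  let ?l = "\<lambda>v. v \<bullet> (M *v v)"
  have ind: "independent {v\<in>E. ?l v = l}" for l
    using eigenbasis_independent[OF E] by (rule independent_mono) auto
  have nz: "v \<noteq> 0" if "v \<in> E" for v using eigenbasis_norm[OF E that] by auto
  have im: "{l. \<exists>v. v \<noteq> 0 \<and> M *v v = l *\<^sub>R v} = ?l ` E"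
  proof (intro set_eqI iffI)
    fix l assume "l \<in> {l. \<exists>v. v \<noteq> 0 \<and> M *v v = l *\<^sub>R v}"
    then obtain v where v: "v \<noteq> 0" "v \<in> span {v\<in>E. ?l v = l}"
      using eigenspace_eq_span[OF E M] by auto
    then have "{v\<in>E. ?l v = l} \<noteq> {}" by (metis singletonD span_empty)
    then show "l \<in> ?l ` E" by blast
  next
    fix l assume "l \<in> ?l ` E"
    then show "l \<in> {l. \<exists>v. v \<noteq> 0 \<and> M *v v = l *\<^sub>R v}"
      using nz eigenbasis_eigen[OF E] by blast
  qed
  have "F M = (\<Sum>l\<in>?l ` E. real (card {v\<in>E. ?l v = l}) * arctan l)"
    unfolding F_def im eigenspace_eq_span[OF E M] dim_span_eq_card_independent[OF ind] ..
  also have "\<dots> = (\<Sum>l\<in>?l ` E. \<Sum>v | v \<in> E \<and> ?l v = l. arctan (?l v))"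
    by (intro sum.cong refl) simp
  also have "\<dots> = (\<Sum>v\<in>E. arctan (?l v))"
    by (rule sum.image_gen[symmetric]) (rule eigenbasis_finite[OF E])
  finally show ?thesis .
qed

text \<open>The trace of (1 + M^2)^(-1) Y, computed in an eigenbasis E of M, so that only the
  diagonal entries of Y in E occur.\<close>

definition dF :: "real^'n^'n \<Rightarrow> (real^'n) set \<Rightarrow> real^'n^'n \<Rightarrow> real" where
  "dF M E Y = (\<Sum>v\<in>E. (v \<bullet> (Y *v v)) / (1 + (v \<bullet> (M *v v))\<^sup>2))"

text \<open>The derivative 1/(1 + z^2) is Lipschitz with constant 1, so the mean value inequality,
  applied to arctan minus its linear part at x, gives a quadratic remainder valid for all x and
  y.\<close>

lemma arctan_second_order:
  "\<bar>arctan y - arctan x - (y - x) / (1 + x\<^sup>2)\<bar> \<le> (y - x)\<^sup>2"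
proof -
  have step: "\<bar>1 / (1 + z\<^sup>2) - 1 / (1 + x\<^sup>2)\<bar> \<le> \<bar>z - x\<bar>" for z :: real
  proof -
    have "1 / (1 + z\<^sup>2) - 1 / (1 + x\<^sup>2) = (x - z) * ((x + z) / ((1 + z\<^sup>2) * (1 + x\<^sup>2)))"
      by (simp add: field_simps add_nonneg_eq_0_iff power2_eq_square)
    moreover have "\<bar>(x + z) / ((1 + z\<^sup>2) * (1 + x\<^sup>2))\<bar> \<le> 1"
    proof -
      have "2 * \<bar>x\<bar> \<le> 1 + x\<^sup>2" "2 * \<bar>z\<bar> \<le> 1 + z\<^sup>2"
        using zero_le_power2[of "\<bar>x\<bar> - 1"] zero_le_power2[of "\<bar>z\<bar> - 1"]
        by (simp_all add: power2_diff)
      moreover have "1 + x\<^sup>2 + z\<^sup>2 \<le> (1 + z\<^sup>2) * (1 + x\<^sup>2)" by (simp add: algebra_simps)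
      ultimately have "\<bar>x + z\<bar> \<le> (1 + z\<^sup>2) * (1 + x\<^sup>2)" by (smt (verit) zero_le_power2)
      then show ?thesis by (simp add: abs_mult divide_le_eq add_nonneg_eq_0_iff)
    qed
    ultimately show ?thesis
      by (metis abs_ge_zero abs_minus_commute abs_mult mult.right_neutral mult_left_mono)
  qed
  have nz: "1 + x\<^sup>2 \<noteq> 0" by (smt (verit) zero_le_power2)
  let ?h = "\<lambda>z. arctan z - z / (1 + x\<^sup>2)"
  have "norm (?h y - ?h x) \<le> \<bar>y - x\<bar> * norm (y - x)"
  proof (rule field_differentiable_bound[of "closed_segment x y" ?h "\<lambda>z. 1 / (1 + z\<^sup>2) - 1 / (1 + x\<^sup>2)"])
    fix z assume z: "z \<in> closed_segment x y"
    have "(?h has_field_derivative (1 / (1 + z\<^sup>2) - 1 / (1 + x\<^sup>2))) (at z)"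
      using nz by (auto intro!: derivative_eq_intros simp: inverse_eq_divide)
    then show "(?h has_field_derivative (1 / (1 + z\<^sup>2) - 1 / (1 + x\<^sup>2))) (at z within closed_segment x y)"
      by (rule has_field_derivative_at_within)
    have "\<bar>z - x\<bar> \<le> \<bar>y - x\<bar>" using z by (auto simp: closed_segment_eq_real_ivl split: if_splits)
    then show "norm (1 / (1 + z\<^sup>2) - 1 / (1 + x\<^sup>2)) \<le> \<bar>y - x\<bar>" using step[of z] by simp
  qed auto
  then show ?thesis
    by (simp add: diff_divide_distrib power2_eq_square abs_mult[symmetric] algebra_simps)
qed

text \<open>As in Klein's inequality, expanding in the two eigenbases turns the remainder into a combination
  of scalar remainders with the weights \<open>(v \<bullet> w)\<^sup>2\<close>.\<close>

lemma F_second_order: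
  fixes M N :: "real^'n^'n"
  assumes M: "M \<in> Sym" "eigenbasis M E" and N: "N \<in> Sym"
  shows "\<bar>F N - F M - dF M E (N - M)\<bar> \<le> (norm (N - M))\<^sup>2"
proof -
  obtain D where D: "eigenbasis N D" using eigenbasis_exists N by blast
  let ?l = "\<lambda>v. v \<bullet> (M *v v)" and ?m = "\<lambda>w. w \<bullet> (N *v w)" and ?c = "\<lambda>v w. (v \<bullet> w)\<^sup>2"
  note fin = eigenbasis_finite[OF M(2)] eigenbasis_finite[OF D]
  \<comment> \<open>The weights (v \<bullet> w)^2 form a doubly stochastic matrix; this allows every
    single sum over E or D to be written as a double sum over both.\<close>
  have one: "(\<Sum>w\<in>D. ?c v w) = 1" if "v \<in> E" for v
    using eigenbasis_parseval[OF D, of v v] eigenbasis_norm[OF M(2) that]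
    by (simp add: dot_square_norm power2_eq_square inner_commute)
  have one': "(\<Sum>v\<in>E. ?c v w) = 1" if "w \<in> D" for w
    using eigenbasis_parseval[OF M(2), of w w] eigenbasis_norm[OF D that]
    by (simp add: dot_square_norm power2_eq_square inner_commute)
  have "F N = (\<Sum>w\<in>D. (\<Sum>v\<in>E. ?c v w) * arctan (?m w))"
    unfolding F_eigenbasis[OF D N] by (simp add: one' cong: sum.cong)
  also have "\<dots> = (\<Sum>v\<in>E. \<Sum>w\<in>D. ?c v w * arctan (?m w))"
    unfolding sum_distrib_right by (rule sum.swap)
  finally have FN: "F N = (\<Sum>v\<in>E. \<Sum>w\<in>D. ?c v w * arctan (?m w))" .
  have FM: "F M = (\<Sum>v\<in>E. \<Sum>w\<in>D. ?c v w * arctan (?l v))"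
    unfolding F_eigenbasis[OF M(2,1)] sum_distrib_right[symmetric] by (simp add: one cong: sum.cong)
  have quad: "v \<bullet> ((N - M) *v v) = (\<Sum>w\<in>D. ?c v w * (?m w - ?l v))" if "v \<in> E" for v
  proof -
    have "(\<Sum>w\<in>D. ?c v w * ?l v) = ?l v"
      by (simp add: sum_distrib_right[symmetric] one[OF that])
    moreover have "v \<bullet> (N *v v) = (\<Sum>w\<in>D. ?c v w * ?m w)"
      unfolding eigenbasis_quadratic[OF D N, of v v]
      by (intro sum.cong refl) (simp add: power2_eq_square inner_commute)
    ultimately show ?thesis
      by (simp add: matrix_vector_mult_diff_rdistrib inner_diff_right right_diff_distrib sum_subtractf)
  qed
  have dF: "dF M E (N - M) = (\<Sum>v\<in>E. \<Sum>w\<in>D. ?c v w * ((?m w - ?l v) / (1 + (?l v)\<^sup>2)))"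
    unfolding dF_def by (intro sum.cong refl) (simp add: quad sum_divide_distrib)
  \<comment> \<open>The entry of N - M between w in D and v in E is (m - l)(v \<bullet> w), so the
    weighted squared eigenvalue differences add up exactly to the Frobenius norm.\<close>
  have nrm: "(norm ((N - M) *v v))\<^sup>2 = (\<Sum>w\<in>D. ?c v w * (?m w - ?l v)\<^sup>2)" if v: "v \<in> E" for v
  proof -
    have "w \<bullet> ((N - M) *v v) = (?m w - ?l v) * (v \<bullet> w)" if w: "w \<in> D" for w
    proof -
      show ?thesis
        using eigenbasis_inner_left[OF D N w, of v] eigenbasis_inner_right[OF M(2) v, of w]
        by (simp only: matrix_vector_mult_diff_rdistrib inner_diff_right left_diff_distrib inner_commute)
    qed
    then show ?thesis
      unfolding dot_square_norm[symmetric] eigenbasis_parseval[OF D, of "(N - M) *v v" "(N - M) *v v"]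
      by (intro sum.cong refl) (simp only: power2_eq_square inner_commute[of "(N - M) *v v"] mult_ac)
  qed
  let ?r = "\<lambda>v w. arctan (?m w) - arctan (?l v) - (?m w - ?l v) / (1 + (?l v)\<^sup>2)"
  have eq: "F N - F M - dF M E (N - M) = (\<Sum>v\<in>E. \<Sum>w\<in>D. ?c v w * ?r v w)"
    unfolding FN FM dF by (simp only: sum_subtractf right_diff_distrib)
  have "\<bar>\<Sum>v\<in>E. \<Sum>w\<in>D. ?c v w * ?r v w\<bar> \<le> (\<Sum>v\<in>E. \<Sum>w\<in>D. \<bar>?c v w * ?r v w\<bar>)"
    by (rule order_trans[OF sum_abs sum_mono[OF sum_abs]])
  also have "\<dots> \<le> (\<Sum>v\<in>E. \<Sum>w\<in>D. ?c v w * (?m w - ?l v)\<^sup>2)"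
    unfolding abs_mult abs_power2 by (intro sum_mono mult_left_mono arctan_second_order zero_le_power2)
  also have "\<dots> = (\<Sum>v\<in>E. (norm ((N - M) *v v))\<^sup>2)"
    by (intro sum.cong refl) (simp only: nrm)
  also have "\<dots> = (norm (N - M))\<^sup>2" by (rule eigenbasis_norm_matrix[OF M(2), symmetric])
  finally show ?thesis unfolding eq .
qed

section \<open>Matrices as vectors\<close>

lemmas matrix_vector_simps = scaleR_matrix_vector_assoc[symmetric] matrix_vector_mult_scaleR
  matrix_vector_right_distrib matrix_vector_mult_diff_distrib matrix_vector_mult_add_rdistrib
  matrix_vector_mult_diff_rdistrib matrix_vector_mul_assoc[symmetric]

lemma Sym_subspace: "subspace (Sym :: (real^'n^'n) set)"
  by (auto simp: subspace_def Sym_def transpose_def vec_eq_iff)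

lemma outer_mult: "outer p q *v x = (q \<bullet> x) *\<^sub>R p"
  by (simp add: vec_eq_iff matrix_vector_mul_component outer_def inner_vec_def sum_distrib_left sum_distrib_right mult_ac)

lemma inner_outer: "outer p q \<bullet> Y = p \<bullet> (Y *v q)"
  by (simp add: inner_vec_def outer_def matrix_vector_mul_component sum_distrib_left mult_ac)

lemma norm_outer: "norm (outer p q) = norm p * norm q"
proof -
  have "(norm (outer p q))\<^sup>2 = (norm p * norm q)\<^sup>2"
    by (simp add: dot_square_norm[symmetric] inner_outer outer_mult power_mult_distrib)
  then show ?thesis by (simp add: power2_eq_iff_nonneg)
qed

lemma outer_Sym: "outer p p \<in> Sym"
  by (simp add: Sym_def outer_def transpose_def mult.commute)

text \<open>Identifies the trace pairing with the Euclidean inner product of matrices, so that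
  Cauchy-Schwarz bounds apply.\<close>

lemma trace_Sym_inner:
  fixes a Y :: "real^'n^'n"
  assumes "a \<in> Sym"
  shows "trace (a ** Y) = a \<bullet> Y"
proof -
  have sym: "a $ i $ k = a $ k $ i" for i k
    using assms by (simp add: Sym_def transpose_def vec_eq_iff)
  have "trace (a ** Y) = (\<Sum>i\<in>UNIV. \<Sum>k\<in>UNIV. a $ i $ k * Y $ k $ i)"
    by (simp add: trace_def matrix_matrix_mult_def)
  also have "\<dots> = (\<Sum>k\<in>UNIV. \<Sum>i\<in>UNIV. a $ k $ i * Y $ k $ i)"
    by (subst sum.swap) (simp add: sym)
  finally show ?thesis by (simp add: inner_vec_def)
qed

lemma bounded_bilinear_matrix_mult: "bounded_bilinear (\<lambda>(A :: real^'n^'n) (B :: real^'n^'n). A ** B)"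
  unfolding bilinear_conv_bounded_bilinear[symmetric] bilinear_def
  by (auto intro!: linearI simp: matrix_matrix_mult_def vec_eq_iff sum.distrib algebra_simps sum_distrib_left)

lemma bounded_bilinear_outer: "bounded_bilinear (outer :: real^'n \<Rightarrow> real^'n \<Rightarrow> real^'n^'n)"
  unfolding bilinear_conv_bounded_bilinear[symmetric] bilinear_def
  by (auto intro!: linearI simp: outer_def vec_eq_iff algebra_simps)

lemmas has_derivative_matrix_mult[derivative_intros] =
  bounded_bilinear.FDERIV[OF bounded_bilinear_matrix_mult]
lemmas has_derivative_outer[derivative_intros] = bounded_bilinear.FDERIV[OF bounded_bilinear_outer]

lemma matrix_inv_eqI:
  fixes S T :: "real^'n^'n"
  assumes "S ** T = mat 1"
  shows "matrix_inv S = T"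
proof -
  have TS: "T ** S = mat 1" using assms by (simp add: matrix_left_right_inverse)
  have "S ** matrix_inv S = mat 1 \<and> matrix_inv S ** S = mat 1"
    unfolding matrix_inv_def by (rule someI[of _ T]) (use assms TS in simp)
  moreover have "matrix_inv S = T ** (S ** matrix_inv S)" by (simp only: matrix_mul_assoc TS matrix_mul_lid)
  ultimately show ?thesis by simp
qed

lemma dF_eq_inner: "dF M E Y = (\<Sum>v\<in>E. (1 / (1 + (v \<bullet> (M *v v))\<^sup>2)) *\<^sub>R outer v v) \<bullet> Y"
  by (simp add: dF_def inner_sum_left inner_outer)

lemma F_has_derivative:
  assumes M: "M \<in> Sym" "eigenbasis M E"
  shows "(F has_derivative dF M E) (at M within Sym)"
proof (rule has_derivativeI_sandwich[of 1 _ _ _ _ "\<lambda>N. norm (N - M)"])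
  show "bounded_linear (dF M E)" unfolding dF_eq_inner[abs_def] by (rule bounded_linear_inner_right)
  have "((\<lambda>N. norm (N - M)) \<longlongrightarrow> norm (M - M)) (at M within Sym)"
    by (intro tendsto_intros)
  then show "((\<lambda>N. norm (N - M)) \<longlongrightarrow> 0) (at M within Sym)" by simp
  show "norm (F N - F M - dF M E (N - M)) / norm (N - M) \<le> norm (N - M)" if "N \<in> Sym" "N \<noteq> M" for N
    using F_second_order[OF M that(1)] that(2)
    by (simp add: divide_le_eq power2_eq_square)
qed simp

section \<open>The matrix \<open>B\<close>\<close>

text \<open>For an eigenvector v of B - C with eigenvalue l, the identity v \<bullet> (B^2 - C^2) v
  = 0 reads l (v \<bullet> B v + v \<bullet> C v) = 0, and the bracket is positive. Hence B - C
  vanishes on an eigenbasis. This settles the definite description in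
  \<open>inv_sqrt\<close>.\<close>

lemma pd_sqrt_unique:
  fixes B C :: "real^'n^'n"
  assumes B: "B \<in> Sym" "\<And>v. v \<noteq> 0 \<Longrightarrow> 0 < v \<bullet> (B *v v)"
    and C: "C \<in> Sym" "\<And>v. v \<noteq> 0 \<Longrightarrow> 0 < v \<bullet> (C *v v)"
    and eq: "B ** B = C ** C"
  shows "B = C"
proof -
  have D: "B - C \<in> Sym" using B(1) C(1) Sym_subspace subspace_diff by blast
  then obtain E where E: "eigenbasis (B - C) E" using eigenbasis_exists by blast
  have z: "(B - C) *v v = 0" if v: "v \<in> E" for v
  proof -
    obtain l where l: "(B - C) *v v = l *\<^sub>R v" using E v unfolding eigenbasis_of_def by blast
    have "v \<noteq> 0" using eigenbasis_norm[OF E v] by auto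
    have "v \<bullet> (B *v (B *v v)) = v \<bullet> (C *v (C *v v))"
      by (simp add: matrix_vector_mul_assoc eq)
    then have "(B *v v - C *v v) \<bullet> (B *v v + C *v v) = 0"
      using Sym_inner[OF B(1), of v "B *v v"] Sym_inner[OF C(1), of v "C *v v"]
      by (simp add: inner_add_right inner_diff_right inner_diff_left inner_commute)
    then have "l * (v \<bullet> (B *v v) + v \<bullet> (C *v v)) = 0"
      using l by (simp add: matrix_vector_mult_diff_rdistrib inner_add_right flip: distrib_left)
    moreover have "v \<bullet> (B *v v) + v \<bullet> (C *v v) > 0" using B(2) C(2) \<open>v \<noteq> 0\<close> by (simp add: add_pos_pos)
    ultimately show ?thesis using l by simp
  qed
  have "(norm (B - C))\<^sup>2 = 0" unfolding eigenbasis_norm_matrix[OF E] by (simp add: z)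
  then show ?thesis by simp
qed

text \<open>\<open>B\<close>, \<open>w\<close> and \<open>A\<close> depend on \<open>(t, p)\<close> only through \<open>y = t p\<close>. Since \<open>B\<close> acts as
  the identity on the complement of \<open>y\<close> and as \<open>1 / w\<close> on \<open>y\<close>, it is a rank one perturbation
  of the identity.\<close>

definition wy :: "real^'n \<Rightarrow> real" where "wy y = sqrt (1 + y \<bullet> y)"
text \<open>Eigenvalue 1/w along y forces the coefficient (1 - 1/w) / |y|^2; with |y|^2 = w^2 - 1
  this becomes 1/(w + w^2), which is regular at y = 0. In the same way (w - 1) / |y|^2 = 1/(1 + w)
  in \<open>By_inv\<close>.\<close>

definition By :: "real^'n \<Rightarrow> real^'n^'n" where "By y = mat 1 - (1 / (wy y + (wy y)\<^sup>2)) *\<^sub>R outer y y"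
definition By_inv :: "real^'n \<Rightarrow> real^'n^'n" where "By_inv y = mat 1 + (1 / (1 + wy y)) *\<^sub>R outer y y"

lemma wy_ge_1: "1 \<le> wy y" and wy_pos: "0 < wy y" and wy_squared: "(wy y)\<^sup>2 = 1 + y \<bullet> y"
proof -
  show ge: "1 \<le> wy y" by (simp add: wy_def)
  then show "0 < wy y" by simp
  show "(wy y)\<^sup>2 = 1 + y \<bullet> y" by (simp add: wy_def add_nonneg_nonneg)
qed

lemma By_mult: "By y *v x = x - (1 / (wy y + (wy y)\<^sup>2) * (y \<bullet> x)) *\<^sub>R y"
  by (simp add: By_def matrix_vector_simps outer_mult)

lemma By_inv_mult: "By_inv y *v x = x + (1 / (1 + wy y) * (y \<bullet> x)) *\<^sub>R y"
  by (simp add: By_inv_def matrix_vector_simps outer_mult)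

lemma mat1_Sym: "mat 1 \<in> Sym"
  by (simp add: Sym_def)

lemma By_Sym: "By y \<in> Sym"
  unfolding By_def by (intro subspace_diff subspace_scale Sym_subspace mat1_Sym outer_Sym)

lemma By_inv_By: "By_inv y *v (By y *v x) = x"
proof -
  define w where "w = wy y"
  have w: "w > 0" "y \<bullet> y = w\<^sup>2 - 1" using wy_pos[of y] wy_squared[of y] by (auto simp: w_def)
  have "1 / (1 + w) * (1 - 1 / (w + w\<^sup>2) * (y \<bullet> y)) - 1 / (w + w\<^sup>2) = 0"
    using w(1) unfolding w(2) by (simp add: field_simps power2_eq_square add_nonneg_eq_0_iff)
  moreover have "By_inv y *v (By y *v x) =
      x + ((1 / (1 + w) * (1 - 1 / (w + w\<^sup>2) * (y \<bullet> y)) - 1 / (w + w\<^sup>2)) * (y \<bullet> x)) *\<^sub>R y"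
    unfolding By_mult By_inv_mult w_def by (simp add: inner_diff_right algebra_simps)
  ultimately show ?thesis by simp
qed

lemma By_pos: "v \<noteq> 0 \<Longrightarrow> 0 < v \<bullet> (By y *v v)"
proof -
  assume v: "v \<noteq> 0"
  define w where "w = wy y"
  have w: "w > 0" "y \<bullet> y = w\<^sup>2 - 1" using wy_pos[of y] wy_squared[of y] by (auto simp: w_def)
  have "(y \<bullet> v)\<^sup>2 \<le> (w\<^sup>2 - 1) * (v \<bullet> v)"
    using Cauchy_Schwarz_ineq[of y v] w by simp
  then have "1 / (w + w\<^sup>2) * (y \<bullet> v)\<^sup>2 \<le> 1 / (w + w\<^sup>2) * ((w\<^sup>2 - 1) * (v \<bullet> v))"
    using w by (intro mult_left_mono) auto
  also have "\<dots> = (1 - 1 / w) * (v \<bullet> v)"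
    using w(1) unfolding w(2) by (simp add: field_simps power2_eq_square add_nonneg_eq_0_iff)
  also have "\<dots> < v \<bullet> v" using v w by (simp add: left_diff_distrib)
  finally show ?thesis
    by (simp add: By_mult inner_diff_right power2_eq_square inner_commute w_def)
qed

lemma By_square: "(mat 1 + outer y y) ** (By y ** By y) = mat 1"
proof -
  define w where "w = wy y"
  have w: "w > 0" "y \<bullet> y = w\<^sup>2 - 1" using wy_pos[of y] wy_squared[of y] by (auto simp: w_def)
  define b where "b = 1 / (w + w\<^sup>2)"
  \<comment> \<open>\<open>By y ** By y\<close> is the identity minus (2b - b^2 |y|^2) times
    \<open>outer y y\<close>; the displayed identity makes this coefficient 1/(1 + |y|^2), as in the
    inverse of a rank one perturbation.\<close>
  have b: "(1 + y \<bullet> y) * (2 * b - b\<^sup>2 * (y \<bullet> y)) = 1"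
  proof -
    have "b * (y \<bullet> y) = 1 - 1 / w" "b * (1 + w) = 1 / w"
      using w(1) unfolding w(2) by (simp_all add: b_def field_simps power2_eq_square add_nonneg_eq_0_iff)
    moreover have "2 * b - b\<^sup>2 * (y \<bullet> y) = b * (2 - b * (y \<bullet> y))"
      by (simp add: power2_eq_square algebra_simps)
    ultimately have "2 * b - b\<^sup>2 * (y \<bullet> y) = b * (1 + 1 / w)" by simp
    also have "\<dots> = (b * (1 + w)) / w" using w by (simp add: field_simps)
    also have "\<dots> = 1 / w\<^sup>2" by (simp add: \<open>b * (1 + w) = 1 / w\<close> power2_eq_square)
    finally show ?thesis using w by simp
  qed
  have "((mat 1 + outer y y) ** (By y ** By y)) *v x = mat 1 *v x" for x
  proof -
    define q where "q = y \<bullet> x"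
    define n where "n = y \<bullet> y"
    have Bm: "By y *v z = z - (b * (y \<bullet> z)) *\<^sub>R y" for z by (simp add: By_mult b_def w_def)
    have "By y *v (By y *v x) = x - (b * q) *\<^sub>R y - (b * (q - b * q * n)) *\<^sub>R y"
      by (simp add: Bm inner_diff_right q_def n_def)
    also have "\<dots> = x - (b * q + b * (q - b * q * n)) *\<^sub>R y" by (simp add: scaleR_add_left)
    also have "b * q + b * (q - b * q * n) = (2 * b - b\<^sup>2 * n) * q"
      by (simp add: power2_eq_square algebra_simps)
    finally have BB: "By y *v (By y *v x) = x - ((2 * b - b\<^sup>2 * n) * q) *\<^sub>R y" .
    have "((mat 1 + outer y y) ** (By y ** By y)) *v x =
        x - ((2 * b - b\<^sup>2 * n) * q) *\<^sub>R y + (q - (2 * b - b\<^sup>2 * n) * q * n) *\<^sub>R y"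
    proof -
      have "(mat 1 + outer y y) *v z = z + (y \<bullet> z) *\<^sub>R y" for z
        by (simp add: matrix_vector_simps outer_mult)
      then show ?thesis
        by (simp only: matrix_vector_mul_assoc[symmetric] BB) (simp add: inner_diff_right q_def n_def)
    qed
    also have "\<dots> = x + (q - (2 * b - b\<^sup>2 * n) * q * n - (2 * b - b\<^sup>2 * n) * q) *\<^sub>R y"
      by (simp add: scaleR_diff_left)
    also have "q - (2 * b - b\<^sup>2 * n) * q * n - (2 * b - b\<^sup>2 * n) * q
        = (1 - (1 + n) * (2 * b - b\<^sup>2 * n)) * q"
      by (simp add: algebra_simps)
    finally show ?thesis using b by (simp add: n_def)
  qed
  then show ?thesis by (simp add: matrix_eq)
qed

lemma wfun_eq: "wfun t p = wy (t *\<^sub>R p)"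
  by (simp add: wfun_def wy_def power2_norm_eq_inner power2_eq_square[of t] mult.assoc)

lemma Bmat_eq:
  fixes p :: "real^'n"
  shows "Bmat t p = By (t *\<^sub>R p)"
proof -
  have o: "t\<^sup>2 *\<^sub>R outer p p = outer (t *\<^sub>R p) (t *\<^sub>R p)"
    by (simp add: outer_def vec_eq_iff power2_eq_square mult_ac)
  show ?thesis unfolding Bmat_def inv_sqrt_def o matrix_inv_eqI[OF By_square]
  proof (rule the_equality)
    fix B :: "real^'n^'n"
    assume "B \<in> Sym \<and> (\<forall>v. v \<noteq> 0 \<longrightarrow> 0 < v \<bullet> (B *v v)) \<and> B ** B = By (t *\<^sub>R p) ** By (t *\<^sub>R p)"
    then show "B = By (t *\<^sub>R p)"
      by - (rule pd_sqrt_unique, auto intro: By_Sym By_pos)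
  qed (use By_Sym By_pos in auto)
qed

definition Ay :: "real^'n^'n \<Rightarrow> real^'n \<Rightarrow> real^'n^'n" where
  "Ay X y = (1 / wy y) *\<^sub>R (By y ** X ** By y)"

lemma Amat_eq: "Amat t p X = Ay X (t *\<^sub>R p)"
  by (simp add: Amat_def Ay_def Bmat_eq wfun_eq)

lemma Ay_mult: "Ay X y *v x = (1 / wy y) *\<^sub>R (By y *v (X *v (By y *v x)))"
  by (simp add: Ay_def matrix_vector_simps)

lemma inner_Ay: "u \<bullet> (Ay X y *v v) = (1 / wy y) * ((By y *v u) \<bullet> (X *v (By y *v v)))"
  by (simp add: Ay_mult Sym_inner[OF By_Sym, of u])

lemma Ay_Sym: "X \<in> Sym \<Longrightarrow> Ay X y \<in> Sym"
  unfolding Sym_iff_inner[of "Ay X y"]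
proof (intro allI)
  fix u v assume X: "X \<in> Sym"
  have "(By y *v u) \<bullet> (X *v (By y *v v)) = (By y *v v) \<bullet> (X *v (By y *v u))"
    by (subst Sym_inner[OF X]) (rule inner_commute)
  then show "u \<bullet> (Ay X y *v v) = (Ay X y *v u) \<bullet> v"
    unfolding inner_commute[of "Ay X y *v u" v] inner_Ay by simp
qed

text \<open>The identity and the rank one part each contribute norm at most 1.\<close>

lemma norm_By_mult: "norm (By y *v x) \<le> 2 * norm x"
proof -
  define w where "w = wy y"
  have w: "w \<ge> 1" "y \<bullet> y = w\<^sup>2 - 1" using wy_ge_1[of y] wy_squared[of y] by (auto simp: w_def)
  have "norm (By y *v x) \<le> norm x + norm ((1 / (w + w\<^sup>2) * (y \<bullet> x)) *\<^sub>R y)"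
    unfolding By_mult w_def by (rule norm_triangle_ineq4)
  also have "norm ((1 / (w + w\<^sup>2) * (y \<bullet> x)) *\<^sub>R y) = 1 / (w + w\<^sup>2) * (\<bar>y \<bullet> x\<bar> * norm y)"
    using w by (simp add: abs_mult)
  also have "\<dots> \<le> 1 / (w + w\<^sup>2) * ((norm y * norm x) * norm y)"
    using w by (intro mult_left_mono mult_right_mono Cauchy_Schwarz_ineq2) auto
  also have "\<dots> = ((y \<bullet> y) / (w + w\<^sup>2)) * norm x"
    by (simp add: dot_square_norm power2_eq_square)
  also have "\<dots> \<le> 1 * norm x"
  proof (intro mult_right_mono norm_ge_zero)
    have "0 < w + w\<^sup>2" using w by (simp add: add_pos_nonneg)
    then show "y \<bullet> y / (w + w\<^sup>2) \<le> 1" using w by (simp add: divide_le_eq)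
  qed
  finally show ?thesis by simp
qed

section \<open>Uniqueness of derivatives within a set\<close>

text \<open>A derivative within S is determined along h by the one-sided derivative on the ray from
  x, so it suffices that this ray starts inside S.\<close>

lemma has_derivative_unique_direction:
  fixes f :: "'a::real_normed_vector \<Rightarrow> 'b::real_normed_vector"
  assumes L: "(f has_derivative L) (at x within S)" and L': "(f has_derivative L') (at x within S)"
    and S: "\<forall>\<^sub>F s in at_right 0. x + s *\<^sub>R h \<in> S"
  shows "L h = L' h"
proof -
  let ?T = "{s::real. s > 0 \<and> x + s *\<^sub>R h \<in> S}"
  have line: "((\<lambda>s. x + s *\<^sub>R h) has_derivative (\<lambda>s. s *\<^sub>R h)) (at 0 within ?T)"
    by (auto intro!: derivative_eq_intros)
  have "((\<lambda>s. f (x + s *\<^sub>R h)) has_derivative (\<lambda>s. A (s *\<^sub>R h))) (at 0 within ?T)"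
    if A: "(f has_derivative A) (at x within S)" for A
    by (rule has_derivative_in_compose[OF line]) (auto intro: has_derivative_subset[OF A])
  note D = this[OF L] this[OF L']
  have "(\<lambda>s. L (s *\<^sub>R h)) = (\<lambda>s. L' (s *\<^sub>R h))"
  proof (rule frechet_derivative_unique_within[OF D])
    fix i e :: real assume i: "i \<in> Basis" and e: "e > 0"
    obtain d where "d > 0" and d: "\<And>s. 0 < s \<Longrightarrow> s < d \<Longrightarrow> x + s *\<^sub>R h \<in> S"
      using S unfolding eventually_at_right_field by auto
    then show "\<exists>d. 0 < \<bar>d\<bar> \<and> \<bar>d\<bar> < e \<and> 0 + d *\<^sub>R i \<in> ?T"
      using i e by (intro exI[of _ "min e d / 2"]) (auto simp: field_simps intro!: d)
  qed
  then show ?thesis by (metis scaleR_one)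
qed

text \<open>An open set of directions enters S at x. Unlike interiority, this holds at boundary
  points of a smooth domain, and it still makes \<open>grad\<close> and \<open>hess\<close> well
  defined.\<close>

definition inner_cone_at :: "'a::real_normed_vector set \<Rightarrow> 'a \<Rightarrow> bool" where
  "inner_cone_at S x \<longleftrightarrow> (\<exists>h0 e. e > 0 \<and> (\<forall>h\<in>ball h0 e. \<forall>\<^sub>F s in at_right 0. x + s *\<^sub>R h \<in> S))"

text \<open>Two linear maps that agree on a ball around h0 agree on h, since h is a multiple of the
  difference of h0 + c h and h0 for small c.\<close>

lemma inner_cone_at_unique:
  fixes f :: "'a::real_normed_vector \<Rightarrow> 'b::real_normed_vector"
  assumes "inner_cone_at S x"
    and L: "(f has_derivative L) (at x within S)" and L': "(f has_derivative L') (at x within S)"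
  shows "L = L'"
proof
  fix h :: 'a
  obtain h0 e where e: "e > 0" and S: "\<And>h. h \<in> ball h0 e \<Longrightarrow> \<forall>\<^sub>F s in at_right 0. x + s *\<^sub>R h \<in> S"
    using assms(1) unfolding inner_cone_at_def by blast
  interpret L: bounded_linear L using L by (rule has_derivative_bounded_linear)
  interpret L': bounded_linear L' using L' by (rule has_derivative_bounded_linear)
  have eq: "L k = L' k" if "k \<in> ball h0 e" for k
    using has_derivative_unique_direction[OF L L' S[OF that]] .
  obtain c where c: "c > 0" "c * norm h < e"
  proof (cases "h = 0")
    case False
    then show ?thesis using e by (intro that[of "e / norm h / 2"]) auto
  qed (use e in \<open>auto intro: that[of 1]\<close>)
  then have "h0 + c *\<^sub>R h \<in> ball h0 e" using c by (simp add: dist_norm)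
  then have "L (h0 + c *\<^sub>R h) = L' (h0 + c *\<^sub>R h)" by (rule eq)
  moreover have "L h0 = L' h0" using e by (intro eq) simp
  ultimately have "c *\<^sub>R L h = c *\<^sub>R L' h"
    by (simp add: L.add L'.add L.scaleR L'.scaleR)
  then show "L h = L' h" using c by simp
qed

lemma inner_cone_at_interior:
  assumes "x \<in> interior S"
  shows "inner_cone_at S x"
proof -
  have "\<forall>\<^sub>F s in at_right 0. x + s *\<^sub>R h \<in> S" for h
  proof -
    have "((\<lambda>s. x + s *\<^sub>R h) \<longlongrightarrow> x + 0 *\<^sub>R h) (at_right 0)" by (intro tendsto_intros)
    then have "\<forall>\<^sub>F s in at_right 0. x + s *\<^sub>R h \<in> interior S"
      using assms by (intro topological_tendstoD) auto
    then show ?thesis by (rule eventually_mono) (use interior_subset in blast)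
  qed
  then show ?thesis unfolding inner_cone_at_def by (intro exI[of _ 0] exI[of _ 1]) simp
qed

lemma grad_eqI:
  assumes "inner_cone_at S x" "(f has_derivative (\<lambda>h. g \<bullet> h)) (at x within S)"
  shows "grad S f x = g"
  unfolding grad_def
proof (rule the_equality)
  fix g' assume "(f has_derivative (\<lambda>h. g' \<bullet> h)) (at x within S)"
  from inner_cone_at_unique[OF assms(1) this assms(2)] have "\<And>h. g' \<bullet> h = g \<bullet> h" by meson
  then show "g' = g" using vector_eq_rdot by blast
qed fact

lemma hess_eqI:
  assumes "inner_cone_at S x" "(grad S f has_derivative (\<lambda>h. H *v h)) (at x within S)"
  shows "hess S f x = H"
  unfolding hess_def
proof (rule the_equality)
  fix H' assume "(grad S f has_derivative (\<lambda>h. H' *v h)) (at x within S)"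
  from inner_cone_at_unique[OF assms(1) this assms(2)] have "\<And>h. H' *v h = H *v h" by meson
  then show "H' = H" by (simp add: matrix_eq)
qed fact

section \<open>The coefficients of the linearised operator\<close>

definition Ey :: "real^'n^'n \<Rightarrow> real^'n \<Rightarrow> (real^'n) set" where
  "Ey X y = (SOME E. eigenbasis (Ay X y) E)"

lemma Ey: "X \<in> Sym \<Longrightarrow> eigenbasis (Ay X y) (Ey X y)"
  unfolding Ey_def by (rule someI_ex[OF eigenbasis_exists[OF Ay_Sym]])

text \<open>The matrix (1/w) B (1 + A^2)^(-1) B, written as a combination of rank one matrices with
  positive weights.\<close>

definition ay :: "real^'n^'n \<Rightarrow> real^'n \<Rightarrow> real^'n^'n" where
  "ay X y = (\<Sum>v\<in>Ey X y. (1 / (wy y * (1 + (v \<bullet> (Ay X y *v v))\<^sup>2))) *\<^sub>R outer (By y *v v) (By y *v v))"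

lemma ay_inner_sum:
  "ay X y \<bullet> Y = (\<Sum>v\<in>Ey X y. (1 / (wy y * (1 + (v \<bullet> (Ay X y *v v))\<^sup>2))) * ((By y *v v) \<bullet> (Y *v (By y *v v))))"
  by (simp add: ay_def inner_sum_left inner_outer)

lemma ay_inner: "ay X y \<bullet> Y = dF (Ay X y) (Ey X y) (Ay Y y)"
  unfolding ay_inner_sum dF_def by (intro sum.cong refl) (simp add: inner_Ay)

lemma ay_Sym: "ay X y \<in> Sym"
  unfolding ay_def by (intro subspace_sum subspace_scale Sym_subspace outer_Sym)

text \<open>Each rank one term pairs with H to a nonnegative number. This later gives the sign of
  a:D^2 chi at the base point.\<close>

lemma ay_inner_nonneg:
  assumes "psd H"
  shows "0 \<le> ay X y \<bullet> H"
  unfolding ay_inner_sum using assms wy_pos[of y]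
  by (intro sum_nonneg mult_nonneg_nonneg) (auto simp: psd_def)

lemma ay_psd: "psd (ay X y)"
  unfolding psd_def
proof (intro conjI allI ay_Sym)
  fix v
  have "v \<bullet> (ay X y *v v) = ay X y \<bullet> outer v v"
    by (metis inner_commute inner_outer)
  also have "\<dots> \<ge> 0"
    by (rule ay_inner_nonneg) (auto simp: psd_def outer_Sym outer_mult inner_commute)
  finally show "0 \<le> v \<bullet> (ay X y *v v)" .
qed

lemma card_Ey: "X \<in> Sym \<Longrightarrow> card (Ey X y) = CARD('n)" for X :: "real^'n^'n"
  using eigenbasis_card Ey by blast

text \<open>Each of the n rank one terms has weight at most 1 and norm |B v|^2 at most 2^2.\<close>

lemma norm_ay_le:
  fixes X :: "real^'n^'n"
  assumes X: "X \<in> Sym"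
  shows "norm (ay X y) \<le> 4 * real CARD('n)"
proof -
  have "norm ((1 / (wy y * (1 + (v \<bullet> (Ay X y *v v))\<^sup>2))) *\<^sub>R outer (By y *v v) (By y *v v)) \<le> 4"
    if v: "v \<in> Ey X y" for v
  proof -
    let ?w = "wy y * (1 + (v \<bullet> (Ay X y *v v))\<^sup>2)"
    have "1 \<le> ?w" using mult_mono[OF wy_ge_1[of y], of 1 "1 + (v \<bullet> (Ay X y *v v))\<^sup>2"] wy_ge_1[of y] by simp
    then have "\<bar>1 / ?w\<bar> \<le> 1" by simp
    moreover have "norm (By y *v v) \<le> 2"
      using norm_By_mult[of y v] eigenbasis_norm[OF Ey[OF X] v] by simp
    then have "norm (By y *v v) * norm (By y *v v) \<le> 2 * 2" by (intro mult_mono) auto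
    ultimately have "\<bar>1 / ?w\<bar> * (norm (By y *v v) * norm (By y *v v)) \<le> 1 * 4"
      by (intro mult_mono) auto
    then show ?thesis by (simp add: norm_outer)
  qed
  then have "norm (ay X y) \<le> (\<Sum>v\<in>Ey X y. 4)" unfolding ay_def by (rule sum_norm_le)
  then show ?thesis by (simp add: card_Ey[OF X])
qed

lemma abs_div_1_plus_square_le: "\<bar>l / (1 + l\<^sup>2)\<bar> \<le> (1::real)"
proof -
  have "2 * \<bar>l\<bar> \<le> 1 + l\<^sup>2" using zero_le_power2[of "\<bar>l\<bar> - 1"] by (simp add: power2_diff)
  then show ?thesis by (simp add: divide_le_eq add_pos_nonneg)
qed

text \<open>A is linear in X, so a:X is the sum of l/(1 + l^2) over the eigenvalues of A, and each
  term is at most 1 in absolute value however large X is.\<close>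

lemma ay_inner_X_le:
  fixes X :: "real^'n^'n"
  assumes X: "X \<in> Sym"
  shows "\<bar>ay X y \<bullet> X\<bar> \<le> real CARD('n)"
proof -
  have "\<bar>ay X y \<bullet> X\<bar> \<le> (\<Sum>v\<in>Ey X y. 1)"
    unfolding ay_inner dF_def
    by (rule order_trans[OF sum_abs sum_mono]) (rule abs_div_1_plus_square_le)
  then show ?thesis by (simp add: card_Ey[OF X])
qed

lemma G_eq: "G t p X = F (Ay X (t *\<^sub>R p))"
  by (simp add: G_def Amat_eq)

lemma F_Ay_has_derivative:
  assumes X: "X \<in> Sym"
  shows "(F has_derivative dF (Ay X y) (Ey X y)) (at (Ay X y) within Sym)"
  by (rule F_has_derivative[OF Ay_Sym[OF X] Ey[OF X]])

lemma acoef_eq: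
  assumes X: "X \<in> Sym"
  shows "acoef (t, p, X) = ay X (t *\<^sub>R p)"
proof -
  define y where "y = t *\<^sub>R p"
  have lin: "((\<lambda>X. Ay X y) has_derivative (\<lambda>H. Ay H y)) (at X within Sym)"
    unfolding Ay_def by (auto intro!: derivative_eq_intros)
  have "((\<lambda>X. F (Ay X y)) has_derivative (\<lambda>H. dF (Ay X y) (Ey X y) (Ay H y))) (at X within Sym)"
    by (rule has_derivative_in_compose[OF lin])
      (auto intro!: has_derivative_subset[OF F_Ay_has_derivative[OF X]] Ay_Sym)
  then have D: "(G t p has_derivative (\<lambda>H. trace (ay X y ** H))) (at X within Sym)"
    by (simp add: G_eq[abs_def] y_def trace_Sym_inner[OF ay_Sym] ay_inner)
  show ?thesis unfolding acoef_def prod.case y_def[symmetric]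
  proof (rule the_equality)
    fix a assume a: "a \<in> Sym \<and> (G t p has_derivative (\<lambda>Y. trace (a ** Y))) (at X within Sym)"
    have diff: "a - ay X y \<in> Sym" using a ay_Sym Sym_subspace subspace_diff by blast
    have "\<forall>\<^sub>F s in at_right 0. X + s *\<^sub>R (a - ay X y) \<in> Sym"
      using X diff by (intro always_eventually allI subspace_add subspace_scale Sym_subspace)
    then have "trace (a ** (a - ay X y)) = trace (ay X y ** (a - ay X y))"
      using has_derivative_unique_direction[OF conjunct2[OF a] D] by blast
    then have "(a - ay X y) \<bullet> (a - ay X y) = 0"
      using a by (simp add: trace_Sym_inner[OF conjunct1[OF a]] trace_Sym_inner[OF ay_Sym] inner_diff_left)
    then show "a = ay X y" by simp
  qed (use D ay_Sym in blast)
qed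

section \<open>The derivative in p and the bound on b\<close>

definition DBy :: "real^'n \<Rightarrow> real^'n \<Rightarrow> real^'n^'n" where
  "DBy y k = ((1 + 2 * wy y) / (wy y * (wy y + (wy y)\<^sup>2)\<^sup>2) * (y \<bullet> k)) *\<^sub>R outer y y
     - (1 / (wy y + (wy y)\<^sup>2)) *\<^sub>R (outer y k + outer k y)"

lemma wy_has_derivative: "(wy has_derivative (\<lambda>k. (y \<bullet> k) / wy y)) (at y)"
proof -
  have "0 < 1 + y \<bullet> y" by (simp add: add_pos_nonneg)
  then show ?thesis unfolding wy_def[abs_def]
    by (auto intro!: derivative_eq_intros simp: field_simps inner_commute)
qed

lemma By_has_derivative:
  fixes y :: "real^'n"
  shows "(By has_derivative DBy y) (at y)"
proof -
  have w: "wy y > 0" by (rule wy_pos)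
  then have w': "wy y + (wy y)\<^sup>2 > 0" by (simp add: add_pos_pos)
  define \<beta> :: "real^'n \<Rightarrow> real" where "\<beta> y = 1 / (wy y + (wy y)\<^sup>2)" for y
  have "(\<beta> has_derivative
      (\<lambda>k. - ((1 + 2 * wy y) / (wy y * (wy y + (wy y)\<^sup>2)\<^sup>2) * (y \<bullet> k)))) (at y)"
    unfolding \<beta>_def using w w' by (auto intro!: derivative_eq_intros wy_has_derivative
        simp: fun_eq_iff field_simps power2_eq_square)
  then show ?thesis unfolding By_def[abs_def] DBy_def[abs_def] \<beta>_def[symmetric]
    by (auto intro!: derivative_eq_intros simp: fun_eq_iff scaleR_add_right)
qed

lemma Ay_has_derivative:
  "(Ay X has_derivative (\<lambda>k. (- (y \<bullet> k) / wy y ^ 3) *\<^sub>R (By y ** X ** By y)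
      + (1 / wy y) *\<^sub>R (DBy y k ** X ** By y + By y ** X ** DBy y k))) (at y)"
proof -
  have w: "wy y > 0" by (rule wy_pos)
  then show ?thesis unfolding Ay_def[abs_def]
    by (auto intro!: derivative_eq_intros wy_has_derivative By_has_derivative
        simp: fun_eq_iff field_simps power3_eq_cube)
qed

lemma DBy_Sym: "DBy y k \<in> Sym"
  unfolding DBy_def
  by (intro subspace_diff subspace_scale Sym_subspace outer_Sym)
    (simp add: Sym_def transpose_def outer_def vec_eq_iff)

text \<open>C^3 comes from differentiating the scalar coefficient, which leaves three factors y; 2C
  comes from the product rule for \<open>outer y y\<close>. The coefficients \<open>c1\<close> and
  \<open>c2\<close> are at most 1 because w is at least 1.\<close>

lemma norm_DBy_mult:
  assumes y: "norm y \<le> C"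
  shows "norm (DBy y k *v v) \<le> (C ^ 3 + 2 * C) * norm k * norm v"
proof -
  define w where "w = wy y"
  have w: "w \<ge> 1" using wy_ge_1[of y] by (simp add: w_def)
  have C: "0 \<le> C" using y norm_ge_zero order_trans by blast
  define c1 where "c1 = (1 + 2 * w) / (w * (w + w\<^sup>2)\<^sup>2)"
  define c2 where "c2 = 1 / (w + w\<^sup>2)"
  have c1: "0 \<le> c1" "c1 \<le> 1"
  proof -
    have "w \<le> w\<^sup>2" using mult_mono[of 1 w w w] w by (simp add: power2_eq_square)
    then have "2 * w \<le> w + w\<^sup>2" by simp
    have "1 + 2 * w \<le> 1 * (w + w\<^sup>2) * 2" using w \<open>w \<le> w\<^sup>2\<close> by simp
    also have "\<dots> \<le> w * (w + w\<^sup>2) * (w + w\<^sup>2)"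
      using w \<open>2 * w \<le> w + w\<^sup>2\<close> by (intro mult_mono) auto
    also have "\<dots> = w * (w + w\<^sup>2)\<^sup>2" by (simp add: power2_eq_square)
    finally show "c1 \<le> 1" using w by (simp add: c1_def divide_le_eq add_pos_pos)
    show "0 \<le> c1" using w by (simp add: c1_def)
  qed
  have c2: "0 \<le> c2" "c2 \<le> 1" using w by (auto simp: c2_def divide_le_eq add_nonneg_nonneg intro: add_increasing2)
  have "DBy y k *v v = (c1 * (y \<bullet> k) * (y \<bullet> v)) *\<^sub>R y - c2 *\<^sub>R ((k \<bullet> v) *\<^sub>R y + (y \<bullet> v) *\<^sub>R k)"
    by (simp add: DBy_def matrix_vector_simps outer_mult c1_def c2_def w_def)
  then have "norm (DBy y k *v v) \<le> norm ((c1 * (y \<bullet> k) * (y \<bullet> v)) *\<^sub>R y)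
      + norm (c2 *\<^sub>R ((k \<bullet> v) *\<^sub>R y + (y \<bullet> v) *\<^sub>R k))"
    by (simp only: norm_triangle_ineq4)
  also have "\<dots> \<le> \<bar>c1 * (y \<bullet> k) * (y \<bullet> v)\<bar> * norm y
      + \<bar>c2\<bar> * (\<bar>k \<bullet> v\<bar> * norm y + \<bar>y \<bullet> v\<bar> * norm k)"
    unfolding norm_scaleR
    by (intro add_left_mono mult_left_mono norm_triangle_le) auto
  also have "\<dots> \<le> (1 * (C * norm k) * (C * norm v)) * C + 1 * ((norm k * norm v) * C + (C * norm v) * norm k)"
  proof (intro add_mono mult_mono)
    show "\<bar>c1 * (y \<bullet> k) * (y \<bullet> v)\<bar> \<le> 1 * (C * norm k) * (C * norm v)"
      unfolding abs_mult using c1 C y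
      by (intro mult_mono order_trans[OF Cauchy_Schwarz_ineq2] mult_right_mono) auto
  qed (use c2 C y in \<open>auto intro!: order_trans[OF Cauchy_Schwarz_ineq2] mult_right_mono\<close>)
  also have "\<dots> = (C ^ 3 + 2 * C) * norm k * norm v" by (simp add: algebra_simps power3_eq_cube)
  finally show ?thesis .
qed

lemma norm_By_inv_mult:
  assumes y: "norm y \<le> C"
  shows "norm (By_inv y *v v) \<le> (1 + C\<^sup>2) * norm v"
proof -
  have C: "0 \<le> C" using y norm_ge_zero order_trans by blast
  have w: "0 \<le> 1 / (1 + wy y)" "1 / (1 + wy y) \<le> 1" using wy_pos[of y] by auto
  have "norm (By_inv y *v v) \<le> norm v + 1 / (1 + wy y) * \<bar>y \<bullet> v\<bar> * norm y"
    unfolding By_inv_mult using norm_triangle_ineq[of v "(1 / (1 + wy y) * (y \<bullet> v)) *\<^sub>R y"] w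
    by (simp add: abs_mult)
  also have "1 / (1 + wy y) * \<bar>y \<bullet> v\<bar> * norm y \<le> 1 * (C * norm v) * C"
    using w y C by (intro mult_mono order_trans[OF Cauchy_Schwarz_ineq2] mult_right_mono) auto
  finally show ?thesis by (simp add: algebra_simps power2_eq_square)
qed

text \<open>The exchange that controls b: on an eigenvector of A the unbounded X is replaced by the
  eigenvalue l times the inverse of B, which is bounded for bounded y.\<close>

lemma By_inv_symmetric_eigen:
  assumes "Ay X y *v v = l *\<^sub>R v"
  shows "X *v (By y *v v) = (wy y * l) *\<^sub>R (By_inv y *v v)"
proof -
  have w: "wy y \<noteq> 0" using wy_pos[of y] by simp
  have "By y *v (X *v (By y *v v)) = wy y *\<^sub>R (Ay X y *v v)"
    using w by (simp add: Ay_mult)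
  then have "By_inv y *v (By y *v (X *v (By y *v v))) = By_inv y *v ((wy y * l) *\<^sub>R v)"
    by (simp add: assms)
  then show ?thesis by (simp add: By_inv_By matrix_vector_mult_scaleR)
qed

text \<open>The summand C pays for the derivative of 1/w, and the doubled product for the two terms
  in which one of the factors B is differentiated.\<close>

definition b_bound :: "real \<Rightarrow> real" where
  "b_bound C = C + 2 * ((C ^ 3 + 2 * C) * (1 + C\<^sup>2))"

lemma norm_bcoef_le:
  fixes X :: "real^'n^'n"
  assumes X: "X \<in> Sym" and t: "0 \<le> t" "t \<le> 1" and p: "norm p \<le> C"
  shows "norm (bcoef (t, p, X)) \<le> real CARD('n) * b_bound C"
proof -
  define y where "y = t *\<^sub>R p"
  have C: "0 \<le> C" using p norm_ge_zero order_trans by blast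
  have y: "norm y \<le> C" using mult_mono[OF t(2) p] t C by (simp add: y_def)
  define A' where "A' k = (- (y \<bullet> k) / wy y ^ 3) *\<^sub>R (By y ** X ** By y)
      + (1 / wy y) *\<^sub>R (DBy y k ** X ** By y + By y ** X ** DBy y k)" for k
  define L where "L h = dF (Ay X y) (Ey X y) (A' (t *\<^sub>R h))" for h
  have "((\<lambda>q. t *\<^sub>R q) has_derivative (\<lambda>h. t *\<^sub>R h)) (at p)"
    by (auto intro!: derivative_eq_intros)
  from has_derivative_compose[OF this] Ay_has_derivative[of X y]
  have "((\<lambda>q. Ay X (t *\<^sub>R q)) has_derivative (\<lambda>h. A' (t *\<^sub>R h))) (at p)"
    unfolding y_def A'_def by blast
  then have "((\<lambda>q. F (Ay X (t *\<^sub>R q))) has_derivative L) (at p)"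
    unfolding L_def
    by (rule has_derivative_in_compose)
      (auto intro!: has_derivative_subset[OF F_Ay_has_derivative[OF X]] Ay_Sym X simp: y_def)
  then have D: "((\<lambda>q. G t q X) has_derivative L) (at p)" by (simp add: G_eq)
  then interpret L: bounded_linear L by (rule has_derivative_bounded_linear)
  \<comment> \<open>The Riesz vector of L, needed because \<open>grad\<close> is described by an
    inner product.\<close>
  have Lg: "L h = (\<Sum>b\<in>Basis. L b *\<^sub>R b) \<bullet> h" for h
  proof -
    have "L h = L (\<Sum>b\<in>Basis. (h \<bullet> b) *\<^sub>R b)" by (simp add: euclidean_representation)
    also have "\<dots> = (\<Sum>b\<in>Basis. L b *\<^sub>R b) \<bullet> h"
      by (simp only: L.sum L.scaleR inner_sum_left inner_scaleR_left) (simp add: inner_commute mult.commute)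
    finally show ?thesis .
  qed
  have "((\<lambda>q. G t q X) has_derivative (\<lambda>h. (\<Sum>b\<in>Basis. L b *\<^sub>R b) \<bullet> h)) (at p)"
    using D unfolding Lg[symmetric] .
  then have b: "bcoef (t, p, X) \<bullet> h = L h" for h
    unfolding bcoef_def prod.case Lg[of h]
    by (subst grad_eqI) (auto intro: inner_cone_at_interior)
  \<comment> \<open>In A' each X stands next to B v, possibly after moving symmetric factors across
    the inner product, so every term carries the factor l and the quotient l/(1 + l^2) splits
    off.\<close>
  have bound: "\<bar>v \<bullet> (A' k *v v)\<bar> / (1 + (v \<bullet> (Ay X y *v v))\<^sup>2) \<le> b_bound C * norm k"
    if v: "v \<in> Ey X y" for v k
  proof -
    define l where "l = v \<bullet> (Ay X y *v v)"
    have l: "Ay X y *v v = l *\<^sub>R v" unfolding l_def by (rule eigenbasis_eigen[OF Ey[OF X] v])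
    have nv: "norm v = 1" by (rule eigenbasis_norm[OF Ey[OF X] v])
    have w: "wy y \<ge> 1" by (rule wy_ge_1)
    note XB = By_inv_symmetric_eigen[OF l]
    let ?z = "DBy y k *v v"
    have 1: "v \<bullet> (DBy y k *v (X *v (By y *v v))) = wy y * l * (?z \<bullet> (By_inv y *v v))"
      by (simp add: Sym_inner[OF DBy_Sym, of v] XB)
    have 2: "v \<bullet> (By y *v (X *v ?z)) = wy y * l * (?z \<bullet> (By_inv y *v v))"
      unfolding Sym_inner[OF By_Sym, of v] Sym_inner[OF X, of "By y *v v"] XB
      by (simp add: inner_commute)
    have 3: "v \<bullet> (By y *v (X *v (By y *v v))) = wy y * l"
      using inner_Ay[of v X y v] w by (simp add: l_def Sym_inner[OF By_Sym, of v])
    have "v \<bullet> (A' k *v v) = - (y \<bullet> k) / wy y ^ 3 * (wy y * l)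
        + 1 / wy y * (wy y * l * (?z \<bullet> (By_inv y *v v)) + wy y * l * (?z \<bullet> (By_inv y *v v)))"
      unfolding A'_def matrix_vector_simps inner_add_right inner_scaleR_right 1 2 3 ..
    also have "\<dots> = l * (- (y \<bullet> k) / (wy y)\<^sup>2 + 2 * (?z \<bullet> (By_inv y *v v)))"
      using w by (simp add: field_simps power2_eq_square power3_eq_cube)
    finally have "v \<bullet> (A' k *v v) = l * (- (y \<bullet> k) / (wy y)\<^sup>2 + 2 * (?z \<bullet> (By_inv y *v v)))" .
    then have "\<bar>v \<bullet> (A' k *v v)\<bar> / (1 + l\<^sup>2)
        = \<bar>l / (1 + l\<^sup>2)\<bar> * \<bar>- (y \<bullet> k) / (wy y)\<^sup>2 + 2 * (?z \<bullet> (By_inv y *v v))\<bar>"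
      by (simp add: abs_mult)
    also have "\<dots> \<le> 1 * \<bar>- (y \<bullet> k) / (wy y)\<^sup>2 + 2 * (?z \<bullet> (By_inv y *v v))\<bar>"
      by (intro mult_right_mono abs_div_1_plus_square_le) auto
    also have "\<dots> \<le> \<bar>y \<bullet> k\<bar> / (wy y)\<^sup>2 + 2 * \<bar>?z \<bullet> (By_inv y *v v)\<bar>"
      using abs_triangle_ineq[of "- (y \<bullet> k) / (wy y)\<^sup>2" "2 * (?z \<bullet> (By_inv y *v v))"]
      by (simp add: abs_mult)
    also have "\<dots> \<le> C * norm k + 2 * (((C ^ 3 + 2 * C) * norm k) * (1 + C\<^sup>2))"
    proof (intro add_mono mult_left_mono)
      have "\<bar>y \<bullet> k\<bar> / (wy y)\<^sup>2 \<le> \<bar>y \<bullet> k\<bar> / 1"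
        using w by (intro divide_left_mono) (auto simp: one_le_power)
      also have "\<dots> \<le> C * norm k" using y Cauchy_Schwarz_ineq2[of y k] mult_right_mono[OF y, of "norm k"] by simp
      finally show "\<bar>y \<bullet> k\<bar> / (wy y)\<^sup>2 \<le> C * norm k" .
      have "\<bar>?z \<bullet> (By_inv y *v v)\<bar> \<le> norm ?z * norm (By_inv y *v v)" by (rule Cauchy_Schwarz_ineq2)
      also have "\<dots> \<le> ((C ^ 3 + 2 * C) * norm k) * (1 + C\<^sup>2)"
        using norm_DBy_mult[OF y, of k v] norm_By_inv_mult[OF y, of v] C nv
        by (intro mult_mono) auto
      finally show "\<bar>?z \<bullet> (By_inv y *v v)\<bar> \<le> ((C ^ 3 + 2 * C) * norm k) * (1 + C\<^sup>2)" .
    qed simp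
    finally show ?thesis by (simp add: l_def b_bound_def algebra_simps)
  qed
  have bb: "0 \<le> b_bound C" using C by (simp add: b_bound_def)
  have Lle: "\<bar>L h\<bar> \<le> real CARD('n) * b_bound C * norm h" for h
  proof -
    have "\<bar>L h\<bar> \<le> (\<Sum>v\<in>Ey X y. b_bound C * norm (t *\<^sub>R h))"
      unfolding L_def dF_def
      by (rule order_trans[OF sum_abs sum_mono]) (use bound[of _ "t *\<^sub>R h"] in \<open>simp add: abs_divide add_nonneg_nonneg\<close>)
    also have "\<dots> = real CARD('n) * b_bound C * norm (t *\<^sub>R h)" by (simp add: card_Ey[OF X])
    also have "\<dots> \<le> real CARD('n) * b_bound C * norm h"
      using t bb by (intro mult_left_mono) (auto intro: mult_left_le_one_le)
    finally show ?thesis .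
  qed
  let ?b = "bcoef (t, p, X)"
  \<comment> \<open>Testing the bound on L with b itself yields the norm of b.\<close>
  have "norm ?b * norm ?b \<le> (real CARD('n) * b_bound C) * norm ?b"
    using Lle[of ?b] b[of ?b] by (simp add: dot_square_norm power2_eq_square)
  then show ?thesis using bb by (cases "norm ?b = 0") auto
qed

section \<open>Smooth functions\<close>

lemma Ck_on_continuous: "Ck_on k S f \<Longrightarrow> continuous_on S f"
  by (cases k) (auto intro: has_derivative_continuous_on)

lemma Ck_on_cong: "Ck_on k S f \<Longrightarrow> (\<And>x. x \<in> S \<Longrightarrow> f' x = f x) \<Longrightarrow> Ck_on k S f'"
proof (cases k)
  case (Suc l)
  assume f: "Ck_on k S f" and eq: "\<And>x. x \<in> S \<Longrightarrow> f' x = f x"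
  then obtain g where g: "\<And>x. x \<in> S \<Longrightarrow> (f has_derivative (\<lambda>h. g x \<bullet> h)) (at x within S)"
      "\<forall>b\<in>Basis. Ck_on l S (\<lambda>x. g x \<bullet> b)"
    using Suc by auto
  have "(f' has_derivative (\<lambda>h. g x \<bullet> h)) (at x within S)" if "x \<in> S" for x
    by (rule has_derivative_transform[OF that eq g(1)[OF that]])
  then show ?thesis using Suc g(2) by auto
qed (metis Ck_on.simps(1) continuous_on_cong)

lemma at_within_Int_open: "x \<in> V \<Longrightarrow> open V \<Longrightarrow> at x within (S \<inter> V) = at x within S"
  by (rule at_within_nhd[of x V]) auto

text \<open>\<open>Ck_on\<close> provides some derivative within S \<inter> V, while
  \<open>grad\<close> and \<open>hess\<close> refer to S. Since V is open the two filters agree, and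
  the cone condition identifies the derivatives. The collar is such a relatively open part of the
  closed domain.\<close>

lemma Ck_on_grad_hess_continuous:
  fixes f :: "real^'n \<Rightarrow> real"
  assumes f: "Ck_on (Suc (Suc k)) (S \<inter> V) f" and V: "open V"
    and cone: "\<And>x. x \<in> S \<inter> V \<Longrightarrow> inner_cone_at S x"
  shows "continuous_on (S \<inter> V) (grad S f)" "continuous_on (S \<inter> V) (hess S f)"
proof -
  let ?T = "S \<inter> V"
  have within: "at x within ?T = at x within S" if "x \<in> ?T" for x
    using at_within_Int_open V that by blast
  obtain g where g: "\<And>x. x \<in> ?T \<Longrightarrow> (f has_derivative (\<lambda>h. g x \<bullet> h)) (at x within ?T)"
    and gC: "\<And>b. b \<in> Basis \<Longrightarrow> Ck_on (Suc k) ?T (\<lambda>x. g x \<bullet> b)"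
    using f by (subst (asm) Ck_on.simps) blast
  have grad: "grad S f x = g x" if "x \<in> ?T" for x
    using g[OF that] cone[OF that] unfolding within[OF that] by (rule grad_eqI[rotated])
  have "\<exists>h. (\<forall>x\<in>?T. ((\<lambda>x. g x \<bullet> b) has_derivative (\<lambda>k. h x \<bullet> k)) (at x within ?T)) \<and>
      (\<forall>b'\<in>Basis. Ck_on k ?T (\<lambda>x. h x \<bullet> b'))" if "b \<in> Basis" for b
    using gC[OF that] by simp
  then obtain h where h: "\<And>b x. b \<in> Basis \<Longrightarrow> x \<in> ?T \<Longrightarrow>
        ((\<lambda>x. g x \<bullet> b) has_derivative (\<lambda>k. h b x \<bullet> k)) (at x within ?T)"
    and hC: "\<And>b b'. b \<in> Basis \<Longrightarrow> b' \<in> Basis \<Longrightarrow> Ck_on k ?T (\<lambda>x. h b x \<bullet> b')"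
    by metis
  \<comment> \<open>Row i of the Hessian is the gradient of the i-th component of g.\<close>
  define H where "H x = (\<chi> i. h (axis i 1) x)" for x
  have Hmult: "(H x *v v) \<bullet> b = h b x \<bullet> v" if "b \<in> Basis" for x v b
    using that by (auto simp: Basis_vec_def H_def inner_axis matrix_vector_mul_component)
  have gD: "(g has_derivative (\<lambda>v. H x *v v)) (at x within ?T)" if "x \<in> ?T" for x
    unfolding has_derivative_componentwise_within[of g] using h[OF _ that] Hmult by simp
  have "(grad S f has_derivative (\<lambda>v. H x *v v)) (at x within S)" if "x \<in> ?T" for x
    using has_derivative_transform[OF that grad gD[OF that]] unfolding within[OF that] .
  then have hess: "hess S f x = H x" if "x \<in> ?T" for x
    using that by (intro hess_eqI cone)
  have "continuous_on ?T g"
    unfolding continuous_on_componentwise[of _ g] using gC Ck_on_continuous by blast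
  then show "continuous_on ?T (grad S f)" by (rule continuous_on_eq) (simp add: grad)
  have "continuous_on ?T (h (axis i 1))" for i
    unfolding continuous_on_componentwise[of _ "h (axis i 1)"]
    using hC[of "axis i 1"] Ck_on_continuous by (auto simp: axis_in_Basis_iff)
  then have "continuous_on ?T H" unfolding H_def by (intro continuous_on_vec_lambda)
  then show "continuous_on ?T (hess S f)" by (rule continuous_on_eq) (simp add: hess)
qed

text \<open>At a boundary point the gradient of the defining function points inwards, and so does
  every direction in the open ball around it that has the origin on its boundary sphere.\<close>

lemma smooth_domain_inner_cone:
  assumes \<Omega>: "smooth_domain \<Omega>" and x: "x \<in> closure \<Omega>"
  shows "inner_cone_at (closure \<Omega>) x"
proof (cases "x \<in> \<Omega>")
  case True
  then show ?thesis using \<Omega> interior_maximal[of \<Omega> "closure \<Omega>"] closure_subset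
    by (intro inner_cone_at_interior) (auto simp: smooth_domain_def)
next
  case False
  then have "x \<in> frontier \<Omega>" using x \<Omega> by (simp add: frontier_def smooth_domain_def interior_open)
  then obtain U \<rho> where U: "open U" "x \<in> U" "smooth_on U \<rho>" "grad UNIV \<rho> x \<noteq> 0"
      "\<Omega> \<inter> U = {x\<in>U. \<rho> x > 0}" "\<rho> x = 0"
    using \<Omega> unfolding smooth_domain_def by fast
  have "Ck_on (Suc 0) U \<rho>" using U(3) by (simp only: smooth_on_def)
  then obtain g where "(\<rho> has_derivative (\<lambda>h. g x \<bullet> h)) (at x within U)" using U(2) by auto
  then have D: "(\<rho> has_derivative (\<lambda>h. g x \<bullet> h)) (at x)"
    using at_within_open U(1,2) by metis
  then have "grad UNIV \<rho> x = g x" by (intro grad_eqI inner_cone_at_interior) auto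
  then have nz: "g x \<noteq> 0" using U(4) by simp
  have "\<forall>\<^sub>F s in at_right 0. x + s *\<^sub>R h \<in> closure \<Omega>" if h: "h \<in> ball (g x) (norm (g x))" for h
  proof -
    have "(norm (g x - h))\<^sup>2 < (norm (g x))\<^sup>2"
      using h by (intro power_strict_mono) (auto simp: dist_norm)
    then have "h \<bullet> h < 2 * (g x \<bullet> h)"
      by (simp add: power2_norm_eq_inner inner_diff_left inner_diff_right inner_commute)
    then have pos: "g x \<bullet> h > 0" using inner_ge_zero[of h] by linarith
    have line: "((\<lambda>s. x + s *\<^sub>R h) has_derivative (\<lambda>s. s *\<^sub>R h)) (at 0)"
      by (auto intro!: derivative_eq_intros)
    have "((\<lambda>s. \<rho> (x + s *\<^sub>R h)) has_derivative (\<lambda>s. g x \<bullet> (s *\<^sub>R h))) (at 0)"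
      by (rule has_derivative_compose[OF line]) (use D in simp)
    then have "((\<lambda>s. \<rho> (x + s *\<^sub>R h)) has_real_derivative (g x \<bullet> h)) (at 0)"
      by (simp add: has_field_derivative_def mult_commute_abs)
    from has_real_derivative_pos_inc_right[OF this pos]
    obtain d where d: "d > 0" "\<And>s. s > 0 \<Longrightarrow> s < d \<Longrightarrow> 0 < \<rho> (x + s *\<^sub>R h)"
      using U(6) by auto
    then have 1: "\<forall>\<^sub>F s in at_right 0. 0 < \<rho> (x + s *\<^sub>R h)"
      unfolding eventually_at_right_field by auto
    have "((\<lambda>s. x + s *\<^sub>R h) \<longlongrightarrow> x + 0 *\<^sub>R h) (at_right 0)" by (intro tendsto_intros)
    then have "\<forall>\<^sub>F s in at_right 0. x + s *\<^sub>R h \<in> U"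
      using U(1,2) by (intro topological_tendstoD) auto
    with 1 show ?thesis
      by eventually_elim (use U(5) closure_subset in blast)
  qed
  then show ?thesis unfolding inner_cone_at_def using nz by (intro exI[of _ "g x"] exI[of _ "norm (g x)"]) auto
qed

text \<open>\<open>dw\<close> and \<open>dd\<close> are derivatives along coordinate lines, which by
  the chain rule are components of the total derivative and so inherit its regularity on the open
  set W.\<close>

lemma Ck_on_partial:
  fixes \<Psi> :: "real \<times> real \<Rightarrow> real"
  assumes \<Psi>: "Ck_on (Suc k) W \<Psi>" and W: "open W"
  shows "Ck_on k W (dw \<Psi>)" "Ck_on k W (dd \<Psi>)"
proof -
  obtain g where g: "\<And>z. z \<in> W \<Longrightarrow> (\<Psi> has_derivative (\<lambda>h. g z \<bullet> h)) (at z within W)"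
    and gC: "\<And>b. b \<in> Basis \<Longrightarrow> Ck_on k W (\<lambda>z. g z \<bullet> b)"
    using \<Psi> by auto
  have D: "(\<Psi> has_derivative (\<lambda>h. g z \<bullet> h)) (at z)" if "z \<in> W" for z
    using g[OF that] at_within_open[OF that W] by simp
  have 1: "dw \<Psi> z = g z \<bullet> (1, 0)" if z: "z \<in> W" for z
  proof -
    have line: "((\<lambda>s. (s, snd z)) has_derivative (\<lambda>h. (h, 0))) (at (fst z))"
      by (auto intro!: derivative_eq_intros)
    have "((\<lambda>s. \<Psi> (s, snd z)) has_derivative (\<lambda>h. g z \<bullet> (h, 0))) (at (fst z))"
      by (rule has_derivative_compose[OF line]) (use D[OF z] in simp)
    then have "((\<lambda>s. \<Psi> (s, snd z)) has_real_derivative (g z \<bullet> (1, 0))) (at (fst z))"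
      by (simp add: has_field_derivative_def inner_prod_def mult_commute_abs)
    then show ?thesis unfolding dw_def by (rule DERIV_imp_deriv)
  qed
  have 2: "dd \<Psi> z = g z \<bullet> (0, 1)" if z: "z \<in> W" for z
  proof -
    have line: "((\<lambda>s. (fst z, s)) has_derivative (\<lambda>h. (0, h))) (at (snd z))"
      by (auto intro!: derivative_eq_intros)
    have "((\<lambda>s. \<Psi> (fst z, s)) has_derivative (\<lambda>h. g z \<bullet> (0, h))) (at (snd z))"
      by (rule has_derivative_compose[OF line]) (use D[OF z] in simp)
    then have "((\<lambda>s. \<Psi> (fst z, s)) has_real_derivative (g z \<bullet> (0, 1))) (at (snd z))"
      by (simp add: has_field_derivative_def inner_prod_def mult_commute_abs)
    then show ?thesis unfolding dd_def by (rule DERIV_imp_deriv)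
  qed
  show "Ck_on k W (dw \<Psi>)" "Ck_on k W (dd \<Psi>)"
    by (rule Ck_on_cong[OF gC 1], simp_all add: Basis_prod_def)
      (rule Ck_on_cong[OF gC 2], simp_all add: Basis_prod_def)
qed

text \<open>The partial derivatives of functions of this form are again of this form.\<close>

lemma Ck_on_exp_quadratic:
  "Ck_on k UNIV (\<lambda>z :: real \<times> real. a * exp (- \<mu> * fst z) + b + c * snd z + e * (snd z)\<^sup>2)"
proof (induction k arbitrary: a b c e)
  case 0
  then show ?case by (auto intro!: continuous_intros)
next
  case (Suc k)
  define f where "f a b c e z = a * exp (- \<mu> * fst z) + b + c * snd z + e * (snd z)\<^sup>2"
    for a b c e and z :: "real \<times> real"
  have Suc': "Ck_on k UNIV (f a b c e)" for a b c e unfolding f_def[abs_def] by (rule Suc)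
  let ?g = "\<lambda>z. (f (- \<mu> * a) 0 0 0 z, f 0 c (2 * e) 0 z)"
  have "(f a b c e has_derivative (\<lambda>h. ?g z \<bullet> h)) (at z)" for z
    unfolding f_def[abs_def]
    by (auto intro!: derivative_eq_intros simp: fun_eq_iff inner_prod_def f_def algebra_simps)
  moreover have "\<forall>b\<in>Basis. Ck_on k UNIV (\<lambda>z. ?g z \<bullet> b)"
    using Suc' by (auto simp: Basis_prod_def)
  ultimately have "Ck_on (Suc k) UNIV (f a b c e)" by (auto intro!: exI[of _ ?g])
  then show ?case unfolding f_def[abs_def] .
qed

lemma Ck_on_const: "Ck_on k S (\<lambda>_. c)"
proof (induction k arbitrary: c)
  case (Suc k)
  then show ?case by (auto intro!: exI[of _ "\<lambda>_. 0"])
qed simp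

lemma grad_const: "grad UNIV (\<lambda>_. c) = (\<lambda>_. 0)"
  by (rule ext, rule grad_eqI) (auto intro: inner_cone_at_interior)

lemma hess_const: "hess UNIV (\<lambda>_. c) = (\<lambda>_. 0)"
  by (rule ext, rule hess_eqI) (auto intro: inner_cone_at_interior simp: grad_const)

lemma Phi_barrier_partials:
  fixes \<tau> :: real
  defines "\<Psi> \<equiv> \<lambda>(s, \<delta>). Phi 1 s + \<tau> * \<delta> - 1 * \<delta>\<^sup>2"
  shows "dw \<Psi> = (\<lambda>z. exp (- fst z))" "dd \<Psi> = (\<lambda>z. \<tau> - 2 * snd z)"
    "dw (dw \<Psi>) = (\<lambda>z. - exp (- fst z))" "dd (dw \<Psi>) = (\<lambda>_. 0)" "dd (dd \<Psi>) = (\<lambda>_. -2)"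
    "smooth_on UNIV \<Psi>"
proof -
  show 1: "dw \<Psi> = (\<lambda>z. exp (- fst z))"
    unfolding dw_def \<Psi>_def Phi_def
    by (rule ext, rule DERIV_imp_deriv) (auto intro!: derivative_eq_intros)
  show 2: "dd \<Psi> = (\<lambda>z. \<tau> - 2 * snd z)"
    unfolding dd_def \<Psi>_def
    by (rule ext, rule DERIV_imp_deriv) (auto intro!: derivative_eq_intros)
  show "dw (dw \<Psi>) = (\<lambda>z. - exp (- fst z))"
    unfolding 1 unfolding dw_def
    by (rule ext, rule DERIV_imp_deriv) (auto intro!: derivative_eq_intros)
  show "dd (dw \<Psi>) = (\<lambda>_. 0)"
    unfolding 1 unfolding dd_def by simp
  show "dd (dd \<Psi>) = (\<lambda>_. -2)"
    unfolding 2 unfolding dd_def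
    by (rule ext, rule DERIV_imp_deriv) (auto intro!: derivative_eq_intros)
  have "Ck_on k UNIV \<Psi>" for k
    by (rule Ck_on_cong[OF Ck_on_exp_quadratic[of k "-1" 1 1 \<tau> "-1"]])
      (auto simp: \<Psi>_def Phi_def algebra_simps)
  then show "smooth_on UNIV \<Psi>" by (simp add: smooth_on_def)
qed

section \<open>Level jets\<close>

text \<open>All that the limit arguments use about the coefficients at a jet, with a single constant
  for a, a:X, b and p.\<close>

definition jet_bound :: "real \<Rightarrow> ('n :: finite) jet \<Rightarrow> bool" where
  "jet_bound C J \<longleftrightarrow> psd (acoef J) \<and> (\<forall>H. psd H \<longrightarrow> 0 \<le> acoef J \<bullet> H) \<and> norm (acoef J) \<le> C \<and>
     \<bar>acoef J \<bullet> jet_X J\<bar> \<le> C \<and> norm (bcoef J) \<le> C \<and> norm (jet_p J) \<le> C"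

lemma level_jet_bound:
  fixes K :: "(real^'n) set"
  assumes "bounded K"
  obtains C where "C \<ge> 0" "\<And>J. level_jet K \<theta> J \<Longrightarrow> jet_bound C J"
proof -
  obtain B where B: "B > 0" "\<And>p. p \<in> K \<Longrightarrow> norm p \<le> B"
    using assms by (auto simp: bounded_pos)
  define C where "C = 4 * real CARD('n) + real CARD('n) * b_bound B + B"
  have bb: "0 \<le> real CARD('n) * b_bound B" using B by (simp add: b_bound_def)
  have "jet_bound C J" if J: "level_jet K \<theta> J" for J
  proof -
    obtain t p X where J': "J = (t, p, X)" by (cases J)
    then have *: "0 \<le> t" "t \<le> 1" "norm p \<le> B" "X \<in> Sym"
      using J B(2) by (auto simp: level_jet_def psd_def)
    show ?thesis
      unfolding jet_bound_def J' acoef_eq[OF *(4)] jet_X_def jet_p_def snd_conv fst_conv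
      using ay_psd ay_inner_nonneg norm_ay_le[OF *(4), of "t *\<^sub>R p"]
        ay_inner_X_le[OF *(4), of "t *\<^sub>R p"] norm_bcoef_le[OF *(4,1-3)] * bb B(1)
      by (auto simp: C_def)
  qed
  then show thesis using that[of C] bb B(1) by (simp add: C_def)
qed

lemma trace_acoef: "jet_bound C J \<Longrightarrow> trace (acoef J ** H) = acoef J \<bullet> H"
  by (rule trace_Sym_inner) (simp add: jet_bound_def psd_def)

lemma aform_nonneg: "jet_bound C J \<Longrightarrow> 0 \<le> aform J \<xi> \<xi>"
  by (simp add: jet_bound_def psd_def aform_def)

text \<open>Positivity of a on \<xi> + \<eta> and \<xi> - \<eta>. It makes the mixed barrier term
  vanish whenever Q and a(Dd, Dd) do.\<close>

lemma aform_cross_le: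
  assumes "jet_bound C J"
  shows "\<bar>2 * aform J \<xi> \<eta>\<bar> \<le> aform J \<xi> \<xi> + aform J \<eta> \<eta>"
proof -
  have S: "\<xi> \<bullet> (acoef J *v \<eta>) = \<eta> \<bullet> (acoef J *v \<xi>)"
    using assms by (subst Sym_inner) (auto simp: jet_bound_def psd_def inner_commute)
  have "0 \<le> aform J (\<xi> + \<eta>) (\<xi> + \<eta>)" "0 \<le> aform J (\<xi> - \<eta>) (\<xi> - \<eta>)"
    by (rule aform_nonneg[OF assms])+
  then show ?thesis using S
    by (simp add: aform_def matrix_vector_simps inner_add_left inner_add_right inner_diff_left inner_diff_right)
qed

lemma inner_bound: "norm x \<le> C \<Longrightarrow> \<bar>x \<bullet> y\<bar> \<le> C * norm y"
  using Cauchy_Schwarz_ineq2[of x y] mult_right_mono[of "norm x" C "norm y"] by fastforce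

lemma Jfun_bound:
  assumes "jet_bound C J"
  shows "\<bar>Jfun \<Omega> u x J\<bar> \<le> C * norm (hess (closure \<Omega>) u x) + C + C * (norm (grad (closure \<Omega>) u x) + C)"
proof -
  have C: "0 \<le> C" using assms norm_ge_zero order_trans unfolding jet_bound_def by blast
  have "\<bar>acoef J \<bullet> hess (closure \<Omega>) u x\<bar> \<le> C * norm (hess (closure \<Omega>) u x)"
    using assms by (intro inner_bound) (simp add: jet_bound_def)
  moreover have "\<bar>acoef J \<bullet> jet_X J\<bar> \<le> C" using assms by (simp add: jet_bound_def)
  moreover have "\<bar>bcoef J \<bullet> (grad (closure \<Omega>) u x - jet_p J)\<bar> \<le> C * norm (grad (closure \<Omega>) u x - jet_p J)"
    using assms by (intro inner_bound) (simp add: jet_bound_def)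
  moreover have "\<dots> \<le> C * (norm (grad (closure \<Omega>) u x) + C)"
    using C assms by (intro mult_left_mono order_trans[OF norm_triangle_ineq4]) (auto simp: jet_bound_def)
  ultimately show ?thesis unfolding Jfun_def trace_acoef[OF assms] inner_diff_right[of "acoef J"] by linarith
qed

lemma lfun_bound:
  assumes "jet_bound C J"
  shows "\<bar>lfun \<Omega> x J\<bar> \<le>
    C * norm (hess (closure \<Omega>) (bdist \<Omega>) x) + C * norm (grad (closure \<Omega>) (bdist \<Omega>) x)"
proof -
  have "\<bar>acoef J \<bullet> hess (closure \<Omega>) (bdist \<Omega>) x\<bar> \<le> C * norm (hess (closure \<Omega>) (bdist \<Omega>) x)"
    "\<bar>bcoef J \<bullet> grad (closure \<Omega>) (bdist \<Omega>) x\<bar> \<le> C * norm (grad (closure \<Omega>) (bdist \<Omega>) x)"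
    using assms by (auto intro!: inner_bound simp: jet_bound_def)
  then show ?thesis unfolding lfun_def trace_acoef[OF assms] by linarith
qed

section \<open>Recession sequences\<close>

lemma Bseq_dominated:
  fixes f g :: "nat \<Rightarrow> real"
  assumes "Bseq g" "\<And>m. \<bar>f m\<bar> \<le> g m"
  shows "Bseq f"
proof (rule Bseq_eventually_mono[OF _ assms(1)], intro always_eventually allI)
  show "norm (f m) \<le> norm (g m)" for m using assms(2)[of m] by simp
qed

lemma slope_inf_pos_imp:
  assumes "slope_inf S \<tau> > 0" "(j, g) \<in> S"
  shows "j + \<tau> * g > 0"
proof -
  have "slope_inf S \<tau> \<le> ereal (j + \<tau> * g)"
    unfolding slope_inf_def using assms(2) by (intro INF_lower2[of "(j, g)"]) auto
  with assms(1) have "0 < ereal (j + \<tau> * g)" by (rule less_le_trans)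
  then show ?thesis by simp
qed

text \<open>A uniform margin c is asked for because pointwise positivity would allow the infimum
  0.\<close>

lemma slope_inf_posI:
  assumes "c > 0" "\<And>j g. (j, g) \<in> S \<Longrightarrow> c \<le> j + \<tau> * g"
  shows "slope_inf S \<tau> > 0"
proof -
  have "ereal c \<le> slope_inf S \<tau>"
    unfolding slope_inf_def using assms(2) by (intro INF_greatest) auto
  moreover have "0 < ereal c" using assms(1) by simp
  ultimately show ?thesis by (rule less_le_trans[rotated])
qed

text \<open>The constant C is fixed once, so that every estimate along a sequence of jets is uniform
  in the sequence.\<close>

locale collar_data =
  fixes \<Omega> K :: "(real^'n) set" and u :: "real^'n \<Rightarrow> real" and \<theta> r Ccol C :: real and x0 :: "real^'n"
  assumes smooth: "smooth_domain \<Omega>" and u: "Ck_on 3 (closure \<Omega>) u"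
    and width: "collar_width \<Omega> r" and Ccol: "Ccol > 0" and x0: "x0 \<in> frontier \<Omega>"
    and C: "C \<ge> 0" and jet_bound: "\<And>J. level_jet K \<theta> J \<Longrightarrow> jet_bound C J"
begin

lemma bdist_nonneg: "0 \<le> bdist \<Omega> x"
  by (simp add: bdist_def infdist_nonneg)

lemma bdist_x0: "bdist \<Omega> x0 = 0"
  using x0 by (simp add: bdist_def)

lemma continuous_bdist: "continuous_on S (bdist \<Omega>)"
  unfolding bdist_def[abs_def] by (intro continuous_intros)

lemma collar_eq: "collar \<Omega> r = closure \<Omega> \<inter> {x. bdist \<Omega> x < r}"
  by (auto simp: collar_def)

lemma open_bdist: "open {x. bdist \<Omega> x < r}"
  by (intro open_Collect_less continuous_bdist continuous_on_const)

lemma x0_collar: "x0 \<in> collar \<Omega> r"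
  using x0 width bdist_x0 by (simp add: collar_def collar_width_def frontier_def)

lemma collar_continuous:
  "continuous_on (collar \<Omega> r) (grad (closure \<Omega>) (bdist \<Omega>))"
  "continuous_on (collar \<Omega> r) (hess (closure \<Omega>) (bdist \<Omega>))"
  "continuous_on (collar \<Omega> r) (grad (closure \<Omega>) u)"
  "continuous_on (collar \<Omega> r) (hess (closure \<Omega>) u)"
proof -
  have "Ck_on (Suc (Suc 0)) (collar \<Omega> r) (bdist \<Omega>)"
    using width unfolding collar_width_def smooth_on_def by blast
  from Ck_on_grad_hess_continuous[OF this[unfolded collar_eq] open_bdist]
  show "continuous_on (collar \<Omega> r) (grad (closure \<Omega>) (bdist \<Omega>))"
    "continuous_on (collar \<Omega> r) (hess (closure \<Omega>) (bdist \<Omega>))"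
    unfolding collar_eq using smooth_domain_inner_cone[OF smooth] by simp_all
  have "Ck_on (Suc (Suc (Suc 0))) (closure \<Omega> \<inter> UNIV) u" using u by (simp add: numeral_3_eq_3)
  from Ck_on_grad_hess_continuous[OF this open_UNIV]
  have "continuous_on (closure \<Omega>) (grad (closure \<Omega>) u)" "continuous_on (closure \<Omega>) (hess (closure \<Omega>) u)"
    using smooth_domain_inner_cone[OF smooth] by simp_all
  then show "continuous_on (collar \<Omega> r) (grad (closure \<Omega>) u)"
    "continuous_on (collar \<Omega> r) (hess (closure \<Omega>) u)"
    by (auto intro: continuous_on_subset simp: collar_def)
qed

lemma collar_tendsto:
  assumes "\<And>m. x m \<in> collar \<Omega> r" "x \<longlonglongrightarrow> x0" "continuous_on (collar \<Omega> r) f"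
  shows "(\<lambda>m. f (x m)) \<longlonglongrightarrow> f x0"
  using assms x0_collar by (intro continuous_on_tendsto_compose[OF assms(3,2)]) auto

lemma recession_set_bound:
  "\<exists>B. \<forall>(j, g)\<in>recession_set \<Omega> r u K \<theta> x0. \<bar>g\<bar> \<le> B"
proof (intro exI ballI, clarify)
  fix j g assume "(j, g) \<in> recession_set \<Omega> r u K \<theta> x0"
  then obtain x J and \<sigma> :: "nat \<Rightarrow> nat" where rec: "recession_seq \<Omega> r u K \<theta> x0 x J" and \<sigma>: "strict_mono \<sigma>"
    and g: "(\<lambda>m. - lfun \<Omega> (x (\<sigma> m)) (J (\<sigma> m))) \<longlonglongrightarrow> g"
    unfolding recession_set_def by blast
  have x: "\<And>m. x (\<sigma> m) \<in> collar \<Omega> r" "(\<lambda>m. x (\<sigma> m)) \<longlonglongrightarrow> x0"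
    using rec LIMSEQ_subseq_LIMSEQ[OF _ \<sigma>, of x x0] by (auto simp: recession_seq_def o_def)
  have "\<bar>- lfun \<Omega> (x (\<sigma> m)) (J (\<sigma> m))\<bar> \<le> C * norm (hess (closure \<Omega>) (bdist \<Omega>) (x (\<sigma> m)))
      + C * norm (grad (closure \<Omega>) (bdist \<Omega>) (x (\<sigma> m)))" for m
    using lfun_bound[OF jet_bound] rec by (simp add: recession_seq_def)
  moreover have "(\<lambda>m. C * norm (hess (closure \<Omega>) (bdist \<Omega>) (x (\<sigma> m)))
      + C * norm (grad (closure \<Omega>) (bdist \<Omega>) (x (\<sigma> m))))
      \<longlonglongrightarrow> C * norm (hess (closure \<Omega>) (bdist \<Omega>) x0) + C * norm (grad (closure \<Omega>) (bdist \<Omega>) x0)"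
    by (intro tendsto_intros collar_continuous[THEN collar_tendsto[OF x]])
  ultimately show "\<bar>g\<bar> \<le> C * norm (hess (closure \<Omega>) (bdist \<Omega>) x0) + C * norm (grad (closure \<Omega>) (bdist \<Omega>) x0)"
    by (intro LIMSEQ_le[OF tendsto_rabs[OF g]]) auto
qed

section \<open>From a barrier to a linear inequality on the recession set\<close>

lemma barrier_recession_limit:
  assumes bar: "core_barrier x0 \<Psi> \<phi>" and neg: "recession_negative \<Omega> r u K \<theta> Ccol x0 \<Psi> \<phi>"
  shows "\<exists>c>0. \<forall>(j, g)\<in>recession_set \<Omega> r u K \<theta> x0. c \<le> dw \<Psi> (0, 0) * j + dd \<Psi> (0, 0) * g"
proof -
  obtain U R \<eta> \<zeta> c where U: "open U" "x0 \<in> U" and pos: "\<eta> > 0" "\<zeta> > 0" "c > 0"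
    and neg: "\<And>x s J. x \<in> U \<inter> collar \<Omega> r \<Longrightarrow> 0 \<le> s \<Longrightarrow> s \<le> Ccol * bdist \<Omega> x \<Longrightarrow>
          level_jet K \<theta> J \<Longrightarrow> opnorm (jet_X J) \<ge> R \<Longrightarrow> anu \<Omega> x J \<le> \<eta> \<Longrightarrow> Qfun \<Omega> u x J \<le> \<zeta>
          \<Longrightarrow> Lop \<Omega> u \<Psi> \<phi> x J s \<le> - c"
    using neg unfolding recession_negative_def by metis
  obtain W where W: "open W" "(0, 0) \<in> W" "smooth_on W \<Psi>" using bar unfolding core_barrier_def by blast
  obtain V where V: "open V" "x0 \<in> V" "smooth_on V \<phi>" using bar unfolding core_barrier_def by blast
  have "Ck_on (Suc (Suc 0)) (UNIV \<inter> V) \<phi>" using V(3) unfolding smooth_on_def by simp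
  note this V(1) inner_cone_at_interior[of _ UNIV]
  from Ck_on_grad_hess_continuous[OF this]
  have cont: "continuous_on V (grad UNIV \<phi>)" "continuous_on V (hess UNIV \<phi>)" by auto
  have \<phi>0: "grad UNIV \<phi> x0 = 0" "psd (hess UNIV \<phi> x0)" using bar by (auto simp: core_barrier_def)
  have Ck: "Ck_on (Suc (Suc 0)) W \<Psi>" using W(3) unfolding smooth_on_def by blast
  note P = Ck_on_partial[OF Ck W(1)]
  note P2 = Ck_on_partial[OF P(1) W(1)] Ck_on_partial[OF P(2) W(1)]
  note contP = P[THEN Ck_on_continuous] P2[THEN Ck_on_continuous]
  have "c \<le> dw \<Psi> (0, 0) * j + dd \<Psi> (0, 0) * g" if jg: "(j, g) \<in> recession_set \<Omega> r u K \<theta> x0" for j g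
  proof -
    from jg obtain x' J' and \<sigma> :: "nat \<Rightarrow> nat" where rec: "recession_seq \<Omega> r u K \<theta> x0 x' J'"
      and \<sigma>: "strict_mono \<sigma>"
      and j': "(\<lambda>m. Jfun \<Omega> u (x' (\<sigma> m)) (J' (\<sigma> m))) \<longlonglongrightarrow> j"
      and g': "(\<lambda>m. - lfun \<Omega> (x' (\<sigma> m)) (J' (\<sigma> m))) \<longlonglongrightarrow> g"
      unfolding recession_set_def by blast
    define x where "x m = x' (\<sigma> m)" for m
    define J where "J m = J' (\<sigma> m)" for m
    have j: "(\<lambda>m. Jfun \<Omega> u (x m) (J m)) \<longlonglongrightarrow> j" using j' by (simp add: x_def J_def)
    have g: "(\<lambda>m. lfun \<Omega> (x m) (J m)) \<longlonglongrightarrow> - g" using tendsto_minus[OF g'] by (simp add: x_def J_def)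
    have sub: "(f \<longlongrightarrow> l) sequentially \<Longrightarrow> ((\<lambda>m. f (\<sigma> m)) \<longlongrightarrow> l) sequentially"
      for f :: "nat \<Rightarrow> 'x::topological_space" and l
      using LIMSEQ_subseq_LIMSEQ[OF _ \<sigma>, of f l] by (simp add: o_def)
    have x: "\<And>m. x m \<in> collar \<Omega> r" "x \<longlonglongrightarrow> x0"
      using rec sub[of x' x0] by (auto simp: recession_seq_def x_def[abs_def])
    have J: "level_jet K \<theta> (J m)" for m using rec by (simp add: recession_seq_def J_def)
    note jb = jet_bound[OF J]
    have anu: "(\<lambda>m. anu \<Omega> (x m) (J m)) \<longlonglongrightarrow> 0" and Q: "(\<lambda>m. Qfun \<Omega> u (x m) (J m)) \<longlonglongrightarrow> 0"
      using rec sub[of "\<lambda>m. anu \<Omega> (x' m) (J' m)" 0] sub[of "\<lambda>m. Qfun \<Omega> u (x' m) (J' m)" 0]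
      by (auto simp: recession_seq_def x_def J_def)
    have opn: "filterlim (\<lambda>m. opnorm (jet_X (J m))) at_top sequentially"
      using rec filterlim_compose[OF _ filterlim_subseq[OF \<sigma>], of "\<lambda>m. opnorm (jet_X (J' m))" at_top]
      by (simp add: recession_seq_def J_def)
    \<comment> \<open>The value s = 0 is admissible at every collar point, as the distance is
      nonnegative.\<close>
    define z where "z m = (0 :: real, bdist \<Omega> (x m))" for m
    have z: "z \<longlonglongrightarrow> (0, 0)"
      using collar_tendsto[OF x continuous_bdist] unfolding z_def bdist_x0 by (intro tendsto_intros)
    have tz: "(\<lambda>m. f (z m)) \<longlonglongrightarrow> f (0, 0)" if "continuous_on W f" for f :: "real \<times> real \<Rightarrow> real"
      using that W(1,2) z continuous_on_eq_continuous_at isCont_tendsto_compose by blast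
    have tV: "(\<lambda>m. f (x m)) \<longlonglongrightarrow> f x0" if "continuous_on V f" for f :: "real^'n \<Rightarrow> 'y::real_normed_vector"
      using that V(1,2) x(2) continuous_on_eq_continuous_at isCont_tendsto_compose by blast
    define cr where "cr m = aform (J m) (jet_p (J m) - grad (closure \<Omega>) u (x m))
        (grad (closure \<Omega>) (bdist \<Omega>) (x m))" for m
    have cr: "cr \<longlonglongrightarrow> 0"
    proof (rule Lim_null_comparison)
      show "\<forall>\<^sub>F m in sequentially. norm (cr m) \<le> Qfun \<Omega> u (x m) (J m) + anu \<Omega> (x m) (J m)"
      proof (intro always_eventually allI)
        fix m
        show "norm (cr m) \<le> Qfun \<Omega> u (x m) (J m) + anu \<Omega> (x m) (J m)"
          using aform_cross_le[OF jb[of m], of "jet_p (J m) - grad (closure \<Omega>) u (x m)"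
              "grad (closure \<Omega>) (bdist \<Omega>) (x m)"]
          unfolding cr_def Qfun_def anu_def real_norm_def by linarith
      qed
      show "(\<lambda>m. Qfun \<Omega> u (x m) (J m) + anu \<Omega> (x m) (J m)) \<longlonglongrightarrow> 0"
        using tendsto_add[OF Q anu] by simp
    qed
    \<comment> \<open>The matrices a need not converge, so only the difference of Hessians is sent
      to 0. What is left, a:D^2 chi(x0), is nonnegative and is discarded below; \<open>T\<close> is
      the operator with this term removed.\<close>
    define hs where "hs m = acoef (J m) \<bullet> (hess UNIV \<phi> (x m) - hess UNIV \<phi> x0)" for m
    have hs: "hs \<longlonglongrightarrow> 0"
    proof (rule Lim_null_comparison)
      show "\<forall>\<^sub>F m in sequentially. norm (hs m) \<le> C * norm (hess UNIV \<phi> (x m) - hess UNIV \<phi> x0)"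
        unfolding hs_def real_norm_def using jb
        by (intro always_eventually allI inner_bound) (simp add: jet_bound_def)
      have "(\<lambda>m. C * norm (hess UNIV \<phi> (x m) - hess UNIV \<phi> x0)) \<longlonglongrightarrow> C * norm (hess UNIV \<phi> x0 - hess UNIV \<phi> x0)"
        by (intro tendsto_intros cont[THEN tV])
      then show "(\<lambda>m. C * norm (hess UNIV \<phi> (x m) - hess UNIV \<phi> x0)) \<longlonglongrightarrow> 0" by simp
    qed
    define gs where "gs m = bcoef (J m) \<bullet> grad UNIV \<phi> (x m)" for m
    have gs: "gs \<longlonglongrightarrow> 0"
    proof (rule Lim_null_comparison)
      show "\<forall>\<^sub>F m in sequentially. norm (gs m) \<le> C * norm (grad UNIV \<phi> (x m))"
        unfolding gs_def real_norm_def using jb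
        by (intro always_eventually allI inner_bound) (simp add: jet_bound_def)
      have "(\<lambda>m. C * norm (grad UNIV \<phi> (x m))) \<longlonglongrightarrow> C * norm (grad UNIV \<phi> x0)"
        by (intro tendsto_intros cont[THEN tV])
      then show "(\<lambda>m. C * norm (grad UNIV \<phi> (x m))) \<longlonglongrightarrow> 0" by (simp add: \<phi>0)
    qed
    define T where "T m = - dw \<Psi> (z m) * Jfun \<Omega> u (x m) (J m) + dd \<Psi> (z m) * lfun \<Omega> (x m) (J m)
        + dw (dw \<Psi>) (z m) * Qfun \<Omega> u (x m) (J m) + 2 * dd (dw \<Psi>) (z m) * cr m
        + dd (dd \<Psi>) (z m) * anu \<Omega> (x m) (J m) + hs m + gs m" for m
    have lim: "T \<longlonglongrightarrow> - dw \<Psi> (0, 0) * j + dd \<Psi> (0, 0) * (- g) + dw (dw \<Psi>) (0, 0) * 0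
        + 2 * dd (dw \<Psi>) (0, 0) * 0 + dd (dd \<Psi>) (0, 0) * 0 + 0 + 0"
      unfolding T_def by (intro tendsto_intros contP[THEN tz] j g Q anu cr hs gs)
    have le: "\<forall>\<^sub>F m in sequentially. T m \<le> - c"
    proof -
      have "\<forall>\<^sub>F m in sequentially. x m \<in> U" using topological_tendstoD[OF x(2) U] .
      moreover have "\<forall>\<^sub>F m in sequentially. R \<le> opnorm (jet_X (J m))"
        using opn by (simp add: filterlim_at_top)
      moreover have "\<forall>\<^sub>F m in sequentially. anu \<Omega> (x m) (J m) < \<eta>" by (rule order_tendstoD(2)[OF anu pos(1)])
      moreover have "\<forall>\<^sub>F m in sequentially. Qfun \<Omega> u (x m) (J m) < \<zeta>" by (rule order_tendstoD(2)[OF Q pos(2)])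
      ultimately show ?thesis
      proof eventually_elim
        case (elim m)
        have "Lop \<Omega> u \<Psi> \<phi> (x m) (J m) 0 \<le> - c"
          using elim x(1) J Ccol bdist_nonneg by (intro neg) auto
        moreover have "0 \<le> acoef (J m) \<bullet> hess UNIV \<phi> x0"
          using jb \<phi>0(2) by (auto simp: jet_bound_def)
        then have "hs m \<le> trace (acoef (J m) ** hess UNIV \<phi> (x m))"
          by (simp add: trace_acoef[OF jb] hs_def inner_diff_right)
        moreover have "Lop \<Omega> u \<Psi> \<phi> (x m) (J m) 0 = T m - hs m + trace (acoef (J m) ** hess UNIV \<phi> (x m))"
          unfolding Lop_def Let_def T_def gs_def cr_def z_def by simp
        ultimately show ?case by linarith
      qed
    qed
    show ?thesis using tendsto_upperbound[OF lim le] by simp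
  qed
  then show ?thesis using pos(3) by (intro exI[of _ c]) auto
qed

text \<open>The gain from \<open>\<mu>\<close> and \<open>N\<close> is not needed: the terms with \<open>Q\<close> and \<open>a(Dd, Dd)\<close> have a good sign
  and vanish along recession sequences, so \<open>\<mu> = N = 1\<close> will do.\<close>

lemma slope_realized:
  assumes \<tau>: "\<tau> > 0" "slope_inf (recession_set \<Omega> r u K \<theta> x0) \<tau> > 0"
  shows "realizes_slope \<Omega> r u K \<theta> Ccol x0 (\<lambda>(s, \<delta>). Phi 1 s + \<tau> * \<delta> - 1 * \<delta>\<^sup>2) (\<lambda>_. 0) \<tau>"
proof -
  let ?\<Psi> = "\<lambda>(s, \<delta>). Phi 1 s + \<tau> * \<delta> - 1 * \<delta>\<^sup>2"
  note partials = Phi_barrier_partials[of \<tau>]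
  have "core_barrier x0 ?\<Psi> (\<lambda>_. 0)"
    unfolding core_barrier_def partials(1,2) grad_const hess_const
    using \<tau>(1) partials(6) Ck_on_const[where S = UNIV]
    by (auto simp: Phi_def smooth_on_def psd_def Sym_def transpose_def vec_eq_iff intro!: exI[of _ UNIV])
  moreover have "recession_negative \<Omega> r u K \<theta> Ccol x0 ?\<Psi> (\<lambda>_. 0)"
  proof (rule ccontr)
    assume not: "\<not> recession_negative \<Omega> r u K \<theta> Ccol x0 ?\<Psi> (\<lambda>_. 0)"
    \<comment> \<open>A single null sequence serves as ball radius, \<eta>, \<zeta> and c at stage
      m, with R = m.\<close>
    define e where "e m = inverse (real (Suc m))" for m
    have e: "e m > 0" for m by (simp add: e_def)
    have e0: "e \<longlonglongrightarrow> 0" unfolding e_def[abs_def] by (rule LIMSEQ_inverse_real_of_nat)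
    define P where "P m x s J \<longleftrightarrow> x \<in> ball x0 (e m) \<inter> collar \<Omega> r \<and> 0 \<le> s \<and> s \<le> Ccol * bdist \<Omega> x \<and>
          level_jet K \<theta> J \<and> opnorm (jet_X J) \<ge> real m \<and> anu \<Omega> x J \<le> e m \<and> Qfun \<Omega> u x J \<le> e m
          \<and> \<not> Lop \<Omega> u ?\<Psi> (\<lambda>_. 0) x J s \<le> - e m"
      for m x s J
    have "\<exists>x s J. P m x s J" for m
    proof (rule ccontr)
      assume "\<not> ?thesis"
      moreover have "open (ball x0 (e m))" "x0 \<in> ball x0 (e m)" using e[of m] by simp_all
      ultimately have "recession_negative \<Omega> r u K \<theta> Ccol x0 ?\<Psi> (\<lambda>_. 0)"
        unfolding P_def recession_negative_def
        by - (rule exI[of _ "ball x0 (e m)"], rule exI[of _ "real m"], (rule exI[of _ "e m"])+,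
          use e[of m] in blast)
      then show False using not by contradiction
    qed
    then obtain x s J where P: "\<And>m. P m (x m) (s m) (J m)" by metis
    have x: "\<And>m. x m \<in> ball x0 (e m)" "\<And>m. x m \<in> collar \<Omega> r"
      and s: "\<And>m. 0 \<le> s m" "\<And>m. s m \<le> Ccol * bdist \<Omega> (x m)"
      and J: "\<And>m. level_jet K \<theta> (J m)" "\<And>m. opnorm (jet_X (J m)) \<ge> real m"
      and small: "\<And>m. anu \<Omega> (x m) (J m) \<le> e m" "\<And>m. Qfun \<Omega> u (x m) (J m) \<le> e m"
      and L: "\<And>m. \<not> Lop \<Omega> u ?\<Psi> (\<lambda>_. 0) (x m) (J m) (s m) \<le> - e m"
      using P unfolding P_def by simp_all
    note jb = jet_bound[OF J(1)]
    have x0': "x \<longlonglongrightarrow> x0"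
    proof (rule tendsto_dist_iff[THEN iffD2])
      show "(\<lambda>m. dist (x m) x0) \<longlonglongrightarrow> 0"
        by (rule Lim_null_comparison[OF _ e0]) (use x(1) in \<open>auto simp: dist_commute less_imp_le\<close>)
    qed
    have anu: "(\<lambda>m. anu \<Omega> (x m) (J m)) \<longlonglongrightarrow> 0"
      by (rule Lim_null_comparison[OF _ e0]) (use small(1) aform_nonneg[OF jb] in \<open>simp add: anu_def\<close>)
    have Q: "(\<lambda>m. Qfun \<Omega> u (x m) (J m)) \<longlonglongrightarrow> 0"
      by (rule Lim_null_comparison[OF _ e0]) (use small(2) aform_nonneg[OF jb] in \<open>simp add: Qfun_def\<close>)
    have "filterlim (\<lambda>m. opnorm (jet_X (J m))) at_top sequentially"
      by (rule filterlim_at_top_mono[OF filterlim_real_sequentially]) (use J(2) in simp)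
    then have rec: "recession_seq \<Omega> r u K \<theta> x0 x J"
      unfolding recession_seq_def using x(2) J(1) x0' anu Q by blast
    have d: "(\<lambda>m. bdist \<Omega> (x m)) \<longlonglongrightarrow> 0"
      using collar_tendsto[OF x(2) x0' continuous_bdist] by (simp add: bdist_x0)
    have s0: "s \<longlonglongrightarrow> 0"
    proof (rule Lim_null_comparison)
      show "\<forall>\<^sub>F m in sequentially. norm (s m) \<le> Ccol * bdist \<Omega> (x m)" using s by simp
      show "(\<lambda>m. Ccol * bdist \<Omega> (x m)) \<longlonglongrightarrow> 0" using tendsto_mult_left[OF d, of Ccol] by simp
    qed
    \<comment> \<open>Continuity of the derivatives of u and d at x0 makes these majorants converge,
      hence bounded; Bolzano-Weierstrass then applies to the pair (J, l).\<close>
    let ?A = "\<lambda>m. C * norm (hess (closure \<Omega>) u (x m)) + C + C * (norm (grad (closure \<Omega>) u (x m)) + C)"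
    let ?B = "\<lambda>m. C * norm (hess (closure \<Omega>) (bdist \<Omega>) (x m)) + C * norm (grad (closure \<Omega>) (bdist \<Omega>) (x m))"
    have "?A \<longlonglongrightarrow> C * norm (hess (closure \<Omega>) u x0) + C + C * (norm (grad (closure \<Omega>) u x0) + C)"
      by (intro tendsto_intros collar_continuous[THEN collar_tendsto[OF x(2) x0']])
    then have "Bseq ?A" by (intro convergent_imp_Bseq convergentI)
    then have BA: "Bseq (\<lambda>m. Jfun \<Omega> u (x m) (J m))"
      by (rule Bseq_dominated) (rule Jfun_bound[OF jb])
    have "?B \<longlonglongrightarrow> C * norm (hess (closure \<Omega>) (bdist \<Omega>) x0) + C * norm (grad (closure \<Omega>) (bdist \<Omega>) x0)"
      by (intro tendsto_intros collar_continuous[THEN collar_tendsto[OF x(2) x0']])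
    then have "Bseq ?B" by (intro convergent_imp_Bseq convergentI)
    then have BB: "Bseq (\<lambda>m. lfun \<Omega> (x m) (J m))"
      by (rule Bseq_dominated) (rule lfun_bound[OF jb])
    have "bounded (range (\<lambda>m. Jfun \<Omega> u (x m) (J m)) \<times> range (\<lambda>m. lfun \<Omega> (x m) (J m)))"
      using BA BB by (intro bounded_Times) (auto simp: Bseq_eq_bounded)
    then have "bounded (range (\<lambda>m. (Jfun \<Omega> u (x m) (J m), lfun \<Omega> (x m) (J m))))"
      by (rule bounded_subset) auto
    then obtain l and \<sigma> :: "nat \<Rightarrow> nat" where \<sigma>: "strict_mono \<sigma>"
      and l: "((\<lambda>m. (Jfun \<Omega> u (x m) (J m), lfun \<Omega> (x m) (J m))) \<circ> \<sigma>) \<longlonglongrightarrow> l"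
      using bounded_imp_convergent_subsequence by blast
    have j: "(\<lambda>m. Jfun \<Omega> u (x (\<sigma> m)) (J (\<sigma> m))) \<longlonglongrightarrow> fst l"
      using tendsto_fst[OF l] by (simp add: o_def)
    have g: "(\<lambda>m. lfun \<Omega> (x (\<sigma> m)) (J (\<sigma> m))) \<longlonglongrightarrow> snd l"
      using tendsto_snd[OF l] by (simp add: o_def)
    \<comment> \<open>The recession set records -l, hence the change of sign in the second
      component.\<close>
    have "(fst l, - snd l) \<in> recession_set \<Omega> r u K \<theta> x0"
      unfolding recession_set_def using rec \<sigma> j tendsto_minus[OF g] by blast
    from slope_inf_pos_imp[OF \<tau>(2) this] have pos: "fst l - \<tau> * snd l > 0" by simp
    have sub: "f \<longlonglongrightarrow> 0 \<Longrightarrow> (\<lambda>m. f (\<sigma> m)) \<longlonglongrightarrow> 0" for f :: "nat \<Rightarrow> real"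
      using LIMSEQ_subseq_LIMSEQ[OF _ \<sigma>, of f 0] by (simp add: o_def)
    \<comment> \<open>The operator on this barrier: the mixed derivative is 0 and chi is constant,
      so only five derivatives of the barrier survive as exponentials or constants in T, affinely in
      the distance for the slope.\<close>
    define T where "T m = - exp (- s (\<sigma> m)) * Jfun \<Omega> u (x (\<sigma> m)) (J (\<sigma> m))
        + (\<tau> - 2 * bdist \<Omega> (x (\<sigma> m))) * lfun \<Omega> (x (\<sigma> m)) (J (\<sigma> m))
        - exp (- s (\<sigma> m)) * Qfun \<Omega> u (x (\<sigma> m)) (J (\<sigma> m)) - 2 * anu \<Omega> (x (\<sigma> m)) (J (\<sigma> m))" for m
    have "T \<longlonglongrightarrow> - exp (- 0) * fst l + (\<tau> - 2 * 0) * snd l - exp (- 0) * 0 - 2 * 0"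
      unfolding T_def by (intro tendsto_intros j g sub[OF s0] sub[OF d] sub[OF anu] sub[OF Q])
    moreover have "- e (\<sigma> m) \<le> T m" for m
    proof -
      have "trace (0 :: real^'n^'n) = 0" by (simp add: trace_def)
      then have "Lop \<Omega> u ?\<Psi> (\<lambda>_. 0) (x (\<sigma> m)) (J (\<sigma> m)) (s (\<sigma> m)) = T m"
        unfolding Lop_def Let_def partials(3-5) unfolding partials(1,2) grad_const hess_const by (simp add: T_def)
      then show ?thesis using L[of "\<sigma> m"] by simp
    qed
    moreover have "(\<lambda>m. - e (\<sigma> m)) \<longlonglongrightarrow> - 0" by (intro tendsto_minus sub e0)
    ultimately have "- 0 \<le> - exp (- 0) * fst l + (\<tau> - 2 * 0) * snd l - exp (- 0) * 0 - 2 * (0 :: real)"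
      by (intro LIMSEQ_le) auto
    then show False using pos by simp
  qed
  ultimately show ?thesis unfolding realizes_slope_def partials(1,2) by simp
qed

lemma barrier_slope:
  assumes bar: "core_barrier x0 \<Psi> \<phi>" and neg: "recession_negative \<Omega> r u K \<theta> Ccol x0 \<Psi> \<phi>"
  shows "dd \<Psi> (0, 0) > 0 \<Longrightarrow>
      slope_inf (recession_set \<Omega> r u K \<theta> x0) (dd \<Psi> (0, 0) / dw \<Psi> (0, 0)) > 0"
    and "dd \<Psi> (0, 0) = 0 \<Longrightarrow>
      \<exists>\<epsilon>0>0. \<forall>\<epsilon>. 0 < \<epsilon> \<and> \<epsilon> \<le> \<epsilon>0 \<longrightarrow> slope_inf (recession_set \<Omega> r u K \<theta> x0) \<epsilon> > 0"
proof -
  let ?cw = "dw \<Psi> (0, 0)" and ?cd = "dd \<Psi> (0, 0)"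
  have cw: "?cw > 0" using bar by (simp add: core_barrier_def)
  obtain c where c: "c > 0"
    and le: "\<And>j g. (j, g) \<in> recession_set \<Omega> r u K \<theta> x0 \<Longrightarrow> c \<le> ?cw * j + ?cd * g"
    using barrier_recession_limit[OF assms] by blast
  have le': "c / ?cw \<le> j + ?cd / ?cw * g" if "(j, g) \<in> recession_set \<Omega> r u K \<theta> x0" for j g
    using le[OF that] cw by (simp add: field_simps)
  then show "slope_inf (recession_set \<Omega> r u K \<theta> x0) (?cd / ?cw) > 0"
    using c cw by (intro slope_inf_posI[of "c / ?cw"]) auto
  assume cd: "?cd = 0"
  obtain B where B: "\<And>j g. (j, g) \<in> recession_set \<Omega> r u K \<theta> x0 \<Longrightarrow> \<bar>g\<bar> \<le> B"
    using recession_set_bound by blast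
  \<comment> \<open>Half of the margin c / c_w is kept and the other half pays for \<epsilon> g. The
    denominator 1 + |B| is positive for every B, also when the recession set is empty and B is
    arbitrary.\<close>
  define \<epsilon>0 where "\<epsilon>0 = c / ?cw / 2 / (1 + \<bar>B\<bar>)"
  have \<epsilon>0: "\<epsilon>0 > 0" "\<epsilon>0 * (1 + \<bar>B\<bar>) = c / ?cw / 2"
    using c cw by (auto simp: \<epsilon>0_def add_pos_nonneg add_nonneg_eq_0_iff)
  have "slope_inf (recession_set \<Omega> r u K \<theta> x0) \<epsilon> > 0" if \<epsilon>: "0 < \<epsilon>" "\<epsilon> \<le> \<epsilon>0" for \<epsilon>
  proof (rule slope_inf_posI[of "c / ?cw / 2"])
    fix j g assume jg: "(j, g) \<in> recession_set \<Omega> r u K \<theta> x0"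
    have "\<bar>\<epsilon> * g\<bar> \<le> \<epsilon>0 * (1 + \<bar>B\<bar>)"
      unfolding abs_mult using \<epsilon> \<epsilon>0 B[OF jg] by (intro mult_mono) auto
    then show "c / ?cw / 2 \<le> j + \<epsilon> * g" using le'[OF jg] \<epsilon>0(2) by (simp add: cd abs_le_iff)
  qed (use c cw in simp)
  then show "\<exists>\<epsilon>0>0. \<forall>\<epsilon>. 0 < \<epsilon> \<and> \<epsilon> \<le> \<epsilon>0 \<longrightarrow> slope_inf (recession_set \<Omega> r u K \<theta> x0) \<epsilon> > 0"
    using \<epsilon>0(1) by blast
qed

end

theorem theorem3p3:
  fixes \<Omega> K :: "(real^'n) set" and u :: "real^'n \<Rightarrow> real"
    and \<theta> r Ccol :: real and x0 :: "real^'n"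
  assumes "CARD('n) \<ge> 2"
    and "smooth_domain \<Omega>" and "bounded \<Omega>"
    and "0 < \<theta>" and "\<theta> < real CARD('n) * pi / 2"
    and "compact K" and "convex K"
    and "Ck_on 3 (closure \<Omega>) u" and "convex_fun_on (closure \<Omega>) u"
    and "collar_width \<Omega> r" and "Ccol > 0"
    and "x0 \<in> frontier \<Omega>"
  shows "((\<exists>\<Psi> \<phi>. core_barrier x0 \<Psi> \<phi> \<and> recession_negative \<Omega> r u K \<theta> Ccol x0 \<Psi> \<phi>)
            \<longleftrightarrow> MRC \<Omega> r u K \<theta> x0)
    \<and> (\<forall>\<Psi> \<phi>. core_barrier x0 \<Psi> \<phi> \<and> recession_negative \<Omega> r u K \<theta> Ccol x0 \<Psi> \<phi> \<longrightarrow>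
         (dd \<Psi> (0, 0) > 0 \<longrightarrow>
            slope_inf (recession_set \<Omega> r u K \<theta> x0) (dd \<Psi> (0, 0) / dw \<Psi> (0, 0)) > 0) \<and>
         (dd \<Psi> (0, 0) = 0 \<longrightarrow>
            (\<exists>\<epsilon>0>0. \<forall>\<epsilon>. 0 < \<epsilon> \<and> \<epsilon> \<le> \<epsilon>0 \<longrightarrow>
               slope_inf (recession_set \<Omega> r u K \<theta> x0) \<epsilon> > 0)))
    \<and> (\<forall>\<tau>>0. slope_inf (recession_set \<Omega> r u K \<theta> x0) \<tau> > 0 \<longrightarrow>
         (\<exists>\<mu>>0. \<exists>N>0. realizes_slope \<Omega> r u K \<theta> Ccol x0
            (\<lambda>(s, \<delta>). Phi \<mu> s + \<tau> * \<delta> - N * \<delta>\<^sup>2) (\<lambda>_. 0) \<tau>))"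
proof -
  obtain C where C: "C \<ge> 0" "\<And>J. level_jet K \<theta> J \<Longrightarrow> jet_bound C J"
    using level_jet_bound[OF compact_imp_bounded[OF assms(6)]] by metis
  interpret collar_data \<Omega> K u \<theta> r Ccol C x0
    by unfold_locales (fact assms C)+
  have realized: "\<exists>\<mu>>0. \<exists>N>0. realizes_slope \<Omega> r u K \<theta> Ccol x0
      (\<lambda>(s, \<delta>). Phi \<mu> s + \<tau> * \<delta> - N * \<delta>\<^sup>2) (\<lambda>_. 0) \<tau>"
    if "\<tau> > 0" "slope_inf (recession_set \<Omega> r u K \<theta> x0) \<tau> > 0" for \<tau>
    using slope_realized[OF that] by (intro exI[of _ 1] conjI) auto
  have "MRC \<Omega> r u K \<theta> x0"
    if b: "core_barrier x0 \<Psi> \<phi>" "recession_negative \<Omega> r u K \<theta> Ccol x0 \<Psi> \<phi>" for \<Psi> \<phi>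
  \<comment> \<open>The quotient c_d / c_w is an admissible slope only if it is positive; for c_d =
    0 a small positive slope takes its place.\<close>
  proof (cases "dd \<Psi> (0, 0) = 0")
    case True
    then show ?thesis using barrier_slope(2)[OF b] unfolding MRC_def by blast
  next
    case False
    then have "dd \<Psi> (0, 0) > 0" "dw \<Psi> (0, 0) > 0" using b(1) by (auto simp: core_barrier_def)
    then show ?thesis using barrier_slope(1)[OF b] unfolding MRC_def
      by (intro exI[of _ "dd \<Psi> (0, 0) / dw \<Psi> (0, 0)"]) simp
  qed
  then have mrc: "MRC \<Omega> r u K \<theta> x0"
    if "\<exists>\<Psi> \<phi>. core_barrier x0 \<Psi> \<phi> \<and> recession_negative \<Omega> r u K \<theta> Ccol x0 \<Psi> \<phi>"
    using that by blast
  have barrier: "\<exists>\<Psi> \<phi>. core_barrier x0 \<Psi> \<phi> \<and> recession_negative \<Omega> r u K \<theta> Ccol x0 \<Psi> \<phi>"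
    if mrc: "MRC \<Omega> r u K \<theta> x0"
  proof -
    obtain \<tau> where "\<tau> > 0" "slope_inf (recession_set \<Omega> r u K \<theta> x0) \<tau> > 0"
      using mrc unfolding MRC_def by blast
    from realized[OF this] show ?thesis unfolding realizes_slope_def by blast
  qed
  show ?thesis
    by (intro conjI allI impI iffI; (elim conjE)?)
      (rule mrc barrier barrier_slope realized; assumption)+
qed

end
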